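(* Let $w=(a_1,\dots,a_{2n})$ be a word of length $2n$ in even integers. Then $h(w)\ge |\mathrm{IConf}(w)|$, where $\mathrm{IConf}(w)$ is the set of irreducible arc configurations of $w$.
   Context: Fix $q\in\mathbb C^\times$ not a root of unity. $U=U_q\widehat{\mathfrak{sl}}_2$ (level zero) is the unital associative $\mathbb C$-algebra with generators $e_0,e_1,f_0,f_1,K^{\pm1}$ and relations $KK^{-1}=K^{-1}K=1$, $Ke_1K^{-1}=q^2e_1$, $Kf_1K^{-1}=q^{-2}f_1$, $Ke_0K^{-1}=q^{-2}e_0$, $Kf_0K^{-1}=q^{2}f_0$, $[e_1,f_1]=-[e_0,f_0]=\frac{K-K^{-1}}{q-q^{-1}}$, $[e_1,f_0]=[e_0,f_1]=0$, and for $i\neq j$ in $\{0,1\}$: $e_i^3e_j-(q^2+1+q^{-2})e_i^2e_je_i+(q^2+1+q^{-2})e_ie_je_i^2-e_je_i^3=0$ and the same relation with $e$ replaced by $f$. Tensor products of $U$-modules are formed with the coproduct $\Delta(K^{\pm1})=K^{\pm1}\otimes K^{\pm1}$, $\Delta(e_0)=e_0\otimes K^{-1}+1\otimes e_0$, $\Delta(f_0)=f_0\otimes 1+K\otimes f_0$, $\Delta(e_1)=e_1\otimes K+1\otimes e_1$, $\Delta(f_1)=f_1\otimes 1+K^{-1}\otimes f_1$. The trivial module $\mathbb C$ has $e_i,f_i$ acting by $0$ and $K$ by $1$. For $a\in 2\mathbb Z$ the two-dimensional evaluation module, denoted simply $a$, has basis $v_+,v_-$ with $Kv_\pm=q^{\pm1}v_\pm$,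 $e_1v_-=v_+$, $e_1v_+=0$, $f_1v_+=v_-$, $f_1v_-=0$, and $e_0,f_0$ acting as $q^{a}f_1$, $q^{-a}e_1$ respectively. A word $w=(a_1,\dots,a_k)$ is a sequence of even integers; it is also regarded as the $U$-module $a_1\otimes\cdots\otimes a_k$. Put $h(w)=\dim\mathrm{Hom}_U(\mathbb C,w)$. An arc in a word $w=(a_1,\dots,a_{2n})$ is a pair of positions $(i,j)$ with $1\le i<j\le 2n$ and $a_j=a_i+2$. An arc configuration of $w$ is a set of $n$ arcs $\{(i_1,j_1),\dots,(i_n,j_n)\}$ such that $\{1,\dots,2n\}$ is the disjoint union of the sets $\{i_k,j_k\}$. Two arcs intersect if, after possibly renaming them, they are $(i_1,j_1),(i_2,j_2)$ with $i_1<i_2<j_1<j_2$; this intersection is called irreducible if $a_{i_2}\notin\{a_{i_1},a_{j_1}\}$ and reducible otherwise. An arc configuration is irreducible if all intersections of pairs of its arcs are irreducible. *)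

theory Defs
  imports
    "Jordan_Normal_Form.VS_Connect"
    "HOL-Library.Disjoint_Sets"
begin

section \<open>Finite-dimensional modules over level-zero quantum affine sl2\<close>

text \<open>
  The algebra \<open>U\<close> is given by generators and relations, so a \<open>U\<close>-module is a vector space with
  operators for the generators that satisfy the defining relations.  All modules needed here are
  finite-dimensional with a distinguished basis, so they are modelled on column vectors, with
  \<open>act M g\<close> the matrix of the generator \<open>g\<close>.  \<open>Kp\<close> and \<open>Km\<close> stand for \<open>K\<close> and its inverse.
\<close>

datatype gen = E0 | E1 | F0 | F1 | Kp | Km

record umod =
  udim :: nat
  act :: "gen \<Rightarrow> complex mat"

definition serre :: "complex \<Rightarrow> complex mat \<Rightarrow> complex mat \<Rightarrow> bool" where
  "serre q x y \<longleftrightarrow>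
     x * x * x * y - (q^2 + 1 + inverse q ^ 2) \<cdot>\<^sub>m (x * x * y * x)
       + (q^2 + 1 + inverse q ^ 2) \<cdot>\<^sub>m (x * y * x * x) - y * x * x * x
     = 0\<^sub>m (dim_row x) (dim_row x)"

definition U_module :: "complex \<Rightarrow> umod \<Rightarrow> bool" where
  "U_module q M \<longleftrightarrow>
     (\<forall>g. act M g \<in> carrier_mat (udim M) (udim M)) \<and>
     act M Kp * act M Km = 1\<^sub>m (udim M) \<and>
     act M Km * act M Kp = 1\<^sub>m (udim M) \<and>
     act M Kp * act M E1 * act M Km = q^2 \<cdot>\<^sub>m act M E1 \<and>
     act M Kp * act M F1 * act M Km = (inverse q ^ 2) \<cdot>\<^sub>m act M F1 \<and>
     act M Kp * act M E0 * act M Km = (inverse q ^ 2) \<cdot>\<^sub>m act M E0 \<and>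
     act M Kp * act M F0 * act M Km = q^2 \<cdot>\<^sub>m act M F0 \<and>
     act M E1 * act M F1 - act M F1 * act M E1
       = (1 / (q - inverse q)) \<cdot>\<^sub>m (act M Kp - act M Km) \<and>
     - (act M E0 * act M F0 - act M F0 * act M E0)
       = (1 / (q - inverse q)) \<cdot>\<^sub>m (act M Kp - act M Km) \<and>
     act M E1 * act M F0 - act M F0 * act M E1 = 0\<^sub>m (udim M) (udim M) \<and>
     act M E0 * act M F1 - act M F1 * act M E0 = 0\<^sub>m (udim M) (udim M) \<and>
     serre q (act M E0) (act M E1) \<and> serre q (act M E1) (act M E0) \<and>
     serre q (act M F0) (act M F1) \<and> serre q (act M F1) (act M F0)"

text \<open>
  Since the generators generate \<open>U\<close>, a linear map is \<open>U\<close>-linear iff it commutes with their action.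
\<close>

definition Hom_U :: "umod \<Rightarrow> umod \<Rightarrow> complex mat set" where
  "Hom_U M N = {X \<in> carrier_mat (udim N) (udim M). \<forall>g. X * act M g = act N g * X}"

definition dim_Hom_U :: "umod \<Rightarrow> umod \<Rightarrow> nat" where
  "dim_Hom_U M N =
     vectorspace.dim class_ring
       ((module_mat TYPE(complex) (udim N) (udim M))\<lparr>carrier := Hom_U M N\<rparr>)"

text \<open>
  The Kronecker product is the matrix of the tensor product of two linear maps with respect to the
  basis \<open>u\<^sub>i \<otimes> v\<^sub>j\<close>, ordered lexicographically.
\<close>

definition kron :: "complex mat \<Rightarrow> complex mat \<Rightarrow> complex mat" (infixl "\<otimes>\<^sub>m" 70) where
  "A \<otimes>\<^sub>m B = mat (dim_row A * dim_row B) (dim_col A * dim_col B)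
     (\<lambda>(i, j). A $$ (i div dim_row B, j div dim_col B) * B $$ (i mod dim_row B, j mod dim_col B))"

fun tensor_act :: "umod \<Rightarrow> umod \<Rightarrow> gen \<Rightarrow> complex mat" where
  "tensor_act M N Kp = act M Kp \<otimes>\<^sub>m act N Kp"
| "tensor_act M N Km = act M Km \<otimes>\<^sub>m act N Km"
| "tensor_act M N E0 = act M E0 \<otimes>\<^sub>m act N Km + 1\<^sub>m (udim M) \<otimes>\<^sub>m act N E0"
| "tensor_act M N F0 = act M F0 \<otimes>\<^sub>m 1\<^sub>m (udim N) + act M Kp \<otimes>\<^sub>m act N F0"
| "tensor_act M N E1 = act M E1 \<otimes>\<^sub>m act N Kp + 1\<^sub>m (udim M) \<otimes>\<^sub>m act N E1"
| "tensor_act M N F1 = act M F1 \<otimes>\<^sub>m 1\<^sub>m (udim N) + act M Km \<otimes>\<^sub>m act N F1"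

definition tensor :: "umod \<Rightarrow> umod \<Rightarrow> umod" where
  "tensor M N = \<lparr>udim = udim M * udim N, act = tensor_act M N\<rparr>"

fun trivial_act :: "gen \<Rightarrow> complex mat" where
  "trivial_act Kp = 1\<^sub>m 1"
| "trivial_act Km = 1\<^sub>m 1"
| "trivial_act _ = 0\<^sub>m 1 1"

definition trivial_umod :: umod where
  "trivial_umod = \<lparr>udim = 1, act = trivial_act\<rparr>"

text \<open>The basis of an evaluation module is \<open>v\<^sub>+, v\<^sub>-\<close>, in this order.\<close>

fun eval_act :: "complex \<Rightarrow> int \<Rightarrow> gen \<Rightarrow> complex mat" where
  "eval_act q a Kp = mat_of_rows_list 2 [[q, 0], [0, inverse q]]"
| "eval_act q a Km = mat_of_rows_list 2 [[inverse q, 0], [0, q]]"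
| "eval_act q a E1 = mat_of_rows_list 2 [[0, 1], [0, 0]]"
| "eval_act q a F1 = mat_of_rows_list 2 [[0, 0], [1, 0]]"
| "eval_act q a E0 = (q powi a) \<cdot>\<^sub>m mat_of_rows_list 2 [[0, 0], [1, 0]]"
| "eval_act q a F0 = (q powi (- a)) \<cdot>\<^sub>m mat_of_rows_list 2 [[0, 1], [0, 0]]"

definition eval_umod :: "complex \<Rightarrow> int \<Rightarrow> umod" where
  "eval_umod q a = \<lparr>udim = 2, act = eval_act q a\<rparr>"

text \<open>
  The recursion ends in the trivial module, the unit of the tensor product: tensoring with it on the
  right leaves every matrix unchanged.
\<close>

primrec word_umod :: "complex \<Rightarrow> int list \<Rightarrow> umod" where
  "word_umod q [] = trivial_umod"
| "word_umod q (a # w) = tensor (eval_umod q a) (word_umod q w)"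

definition word_h :: "complex \<Rightarrow> int list \<Rightarrow> nat" where
  "word_h q w = dim_Hom_U trivial_umod (word_umod q w)"


section \<open>Arc configurations\<close>

text \<open>Positions in a word are list indices, hence counted from 0.\<close>

definition arcs :: "int list \<Rightarrow> (nat \<times> nat) set" where
  "arcs w = {(i, j). i < j \<and> j < length w \<and> w ! j = w ! i + 2}"

definition arc_config :: "int list \<Rightarrow> (nat \<times> nat) set \<Rightarrow> bool" where
  "arc_config w C \<longleftrightarrow>
     C \<subseteq> arcs w \<and> 2 * card C = length w \<and>
     disjoint_family_on (\<lambda>(i, j). {i, j}) C \<and> (\<Union>(i, j)\<in>C. {i, j}) = {..<length w}"

fun arcs_intersect :: "nat \<times> nat \<Rightarrow> nat \<times> nat \<Rightarrow> bool" where
  "arcs_intersect (i1, j1) (i2, j2) \<longleftrightarrow> i1 < i2 \<and> i2 < j1 \<and> j1 < j2"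

fun irreducible_intersection :: "int list \<Rightarrow> nat \<times> nat \<Rightarrow> nat \<times> nat \<Rightarrow> bool" where
  "irreducible_intersection w (i1, j1) (i2, j2) \<longleftrightarrow> w ! i2 \<notin> {w ! i1, w ! j1}"

text \<open>\<open>arcs_intersect\<close> is oriented; quantifying over ordered pairs covers both namings of the arcs.\<close>

definition irreducible_config :: "int list \<Rightarrow> (nat \<times> nat) set \<Rightarrow> bool" where
  "irreducible_config w C \<longleftrightarrow>
     (\<forall>p\<in>C. \<forall>r\<in>C. arcs_intersect p r \<longrightarrow> irreducible_intersection w p r)"

definition IConf :: "int list \<Rightarrow> (nat \<times> nat) set set" where
  "IConf w = {C. arc_config w C \<and> irreducible_config w C}"


section \<open>Words are modules over level-zero quantum affine sl2\<close>

lemma kron_dim [simp]: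
  "dim_row (A \<otimes>\<^sub>m B) = dim_row A * dim_row B" "dim_col (A \<otimes>\<^sub>m B) = dim_col A * dim_col B"
  by (simp_all add: kron_def)

lemma kron_carrier:
  "A \<in> carrier_mat a b \<Longrightarrow> B \<in> carrier_mat c d \<Longrightarrow> A \<otimes>\<^sub>m B \<in> carrier_mat (a * c) (b * d)"
  by (rule carrier_matI) (simp_all only: kron_dim carrier_matD)

lemma div_mod_lt:
  assumes "(i::nat) < a * b"
  shows "i div b < a" "i mod b < b"
proof -
  show "i div b < a" using assms by (rule less_mult_imp_div_less)
  have "0 < b" using assms by (cases "b = 0") auto
  then show "i mod b < b" by simp
qed

lemma kron_index:
  "i < dim_row A * dim_row B \<Longrightarrow> j < dim_col A * dim_col B \<Longrightarrow>
   (A \<otimes>\<^sub>m B) $$ (i, j) =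
     A $$ (i div dim_row B, j div dim_col B) * B $$ (i mod dim_row B, j mod dim_col B)"
  by (simp add: kron_def)

lemma sum_div_mod:
  fixes f :: "nat \<Rightarrow> nat \<Rightarrow> 'a::comm_monoid_add"
  shows "(\<Sum>k<a * b. f (k div b) (k mod b)) = (\<Sum>i<a. \<Sum>j<b. f i j)"
proof -
  have "(\<Sum>i<a. \<Sum>j<b. f i j) = (\<Sum>(i,j)\<in>{..<a}\<times>{..<b}. f i j)"
    by (simp add: sum.cartesian_product)
  also have "\<dots> = (\<Sum>k<a * b. f (k div b) (k mod b))"
  proof (rule sum.reindex_bij_witness[where i = "\<lambda>k. (k div b, k mod b)" and j = "\<lambda>(i,j). i * b + j"], goal_cases)
    case (2 p)
    then obtain i j where p: "p = (i, j)" and ij: "i < a" "j < b" by auto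
    from ij have "i * b + j < Suc i * b" by simp
    also have "\<dots> \<le> a * b" using ij by (intro mult_le_mono1) simp
    finally show ?case using p by simp
  next
    case (4 k)
    then show ?case using div_mod_lt[of k a b] by simp
  qed auto
  finally show ?thesis by simp
qed

lemma kron_mult:
  assumes "A \<in> carrier_mat m m" "C \<in> carrier_mat m m" "B \<in> carrier_mat n n" "D \<in> carrier_mat n n"
  shows "(A \<otimes>\<^sub>m B) * (C \<otimes>\<^sub>m D) = (A * C) \<otimes>\<^sub>m (B * D)"
proof (rule eq_matI, goal_cases)
  case (1 i j)
  then have ij: "i < m * n" "j < m * n" using assms by auto
  have *: "k < m * n \<Longrightarrow> k div n < m" "k < m * n \<Longrightarrow> k mod n < n" for k
    by (simp_all add: div_mod_lt[of k m n])
  have "((A \<otimes>\<^sub>m B) * (C \<otimes>\<^sub>m D)) $$ (i, j) =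
      (\<Sum>k<m * n. (A $$ (i div n, k div n) * B $$ (i mod n, k mod n)) *
                   (C $$ (k div n, j div n) * D $$ (k mod n, j mod n)))"
    using ij assms by (auto simp: scalar_prod_def kron_index lessThan_atLeast0 intro!: sum.cong)
  also have "\<dots> = (\<Sum>k<m. \<Sum>l<n. (A $$ (i div n, k) * B $$ (i mod n, l)) *
                   (C $$ (k, j div n) * D $$ (l, j mod n)))"
    by (rule sum_div_mod[where f = "\<lambda>k l. (A $$ (i div n, k) * B $$ (i mod n, l)) *
                   (C $$ (k, j div n) * D $$ (l, j mod n))"])
  also have "\<dots> = (\<Sum>k<m. A $$ (i div n, k) * C $$ (k, j div n)) *
                   (\<Sum>l<n. B $$ (i mod n, l) * D $$ (l, j mod n))"
    by (simp add: sum_product mult_ac)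
  also have "\<dots> = ((A * C) \<otimes>\<^sub>m (B * D)) $$ (i, j)"
    using ij * assms by (auto simp: scalar_prod_def kron_index lessThan_atLeast0)
  finally show ?case .
qed (use assms in auto)

lemma kron_smult:
  "(c \<cdot>\<^sub>m A) \<otimes>\<^sub>m B = c \<cdot>\<^sub>m (A \<otimes>\<^sub>m B)" "A \<otimes>\<^sub>m (c \<cdot>\<^sub>m B) = c \<cdot>\<^sub>m (A \<otimes>\<^sub>m B)"
  by (rule eq_matI;
      simp add: kron_index div_mod_lt(1) div_mod_lt(2)[of _ "dim_row A"] div_mod_lt(2)[of _ "dim_col A"])+

lemma kron_one: "1\<^sub>m m \<otimes>\<^sub>m 1\<^sub>m n = (1\<^sub>m (m * n) :: complex mat)"
proof (rule eq_matI, goal_cases)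
  case (1 i j)
  then have ij: "i < m * n" "j < m * n" by auto
  have "i = j" if "i div n = j div n" "i mod n = j mod n"
    using that by (metis div_mult_mod_eq)
  with ij div_mod_lt[OF ij(1)] div_mod_lt[OF ij(2)] show ?case by (auto simp: kron_index)
qed auto

lemma kron_lin:
  assumes "A \<in> carrier_mat m m" "B \<in> carrier_mat m m" "C \<in> carrier_mat n n"
  shows "(A + B) \<otimes>\<^sub>m C = A \<otimes>\<^sub>m C + B \<otimes>\<^sub>m C" "(A - B) \<otimes>\<^sub>m C = A \<otimes>\<^sub>m C - B \<otimes>\<^sub>m C"
    "C \<otimes>\<^sub>m (A + B) = C \<otimes>\<^sub>m A + C \<otimes>\<^sub>m B" "C \<otimes>\<^sub>m (A - B) = C \<otimes>\<^sub>m A - C \<otimes>\<^sub>m B"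
  by (rule eq_matI; simp add: carrier_matD[OF assms(1)] carrier_matD[OF assms(2)]
        carrier_matD[OF assms(3)] kron_index ring_distribs div_mod_lt(1)
        div_mod_lt(2)[of _ m n] div_mod_lt(2)[of _ n m])+

lemma kron_zero:
  assumes "A \<in> carrier_mat m m"
  shows "A \<otimes>\<^sub>m 0\<^sub>m n n = 0\<^sub>m (m * n) (m * n)" "0\<^sub>m n n \<otimes>\<^sub>m A = 0\<^sub>m (n * m) (n * m)"
  by (rule eq_matI; simp add: carrier_matD[OF assms] kron_index div_mod_lt(1)
        div_mod_lt(2)[of _ m n] div_mod_lt(2)[of _ n m])+

text \<open>
  Serre relations are checked on operators: \<open>mop A\<close> is the linear operator of a square matrix \<open>A\<close>
  on a type that does not depend on the size of \<open>A\<close>.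
\<close>

definition mop :: "complex mat \<Rightarrow> (nat \<Rightarrow> complex) \<Rightarrow> nat \<Rightarrow> complex" where
  "mop A f = (\<lambda>i. if i < dim_row A then \<Sum>j<dim_col A. A $$ (i,j) * f j else 0)"

lemma mop_mult:
  assumes "dim_col A = dim_row B" shows "mop (A * B) f = mop A (mop B f)"
proof
  fix i
  show "mop (A * B) f i = mop A (mop B f) i"
  proof (cases "i < dim_row A")
    case True
    have "mop (A * B) f i = (\<Sum>j<dim_col B. \<Sum>k<dim_row B. A $$ (i,k) * B $$ (k,j) * f j)"
      using True assms by (simp add: mop_def scalar_prod_def lessThan_atLeast0 sum_distrib_right)
    also have "\<dots> = (\<Sum>k<dim_row B. \<Sum>j<dim_col B. A $$ (i,k) * B $$ (k,j) * f j)"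
      by (rule sum.swap)
    also have "\<dots> = mop A (mop B f) i" using True assms
      by (simp add: mop_def sum_distrib_left mult.assoc)
    finally show ?thesis .
  qed (simp add: mop_def)
qed

lemma mop_add:
  assumes "dim_row A = dim_row B" "dim_col A = dim_col B"
  shows "mop (A + B) f = (\<lambda>i. mop A f i + mop B f i)"
    "mop (A - B) f = (\<lambda>i. mop A f i - mop B f i)"
  using assms by (auto simp: mop_def fun_eq_iff sum.distrib sum_subtractf algebra_simps)
lemma mop_smult: "mop (c \<cdot>\<^sub>m A) f = (\<lambda>i. c * mop A f i)"
  by (auto simp: mop_def fun_eq_iff sum_distrib_left mult.assoc)
lemma mop_lin: "mop A (\<lambda>i. f i + g i) = (\<lambda>i. mop A f i + mop A g i)"
   "mop A (\<lambda>i. c * g i) = (\<lambda>i. c * mop A g i)"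
  by (auto simp: mop_def fun_eq_iff sum.distrib sum_distrib_left algebra_simps)
lemma mop_zero: "mop (0\<^sub>m n n) f = (\<lambda>i. 0)" by (auto simp: mop_def)

lemma mop_inject:
  assumes "A \<in> carrier_mat n n" "B \<in> carrier_mat n n" "\<And>f. mop A f = mop B f"
  shows "A = B"
proof (rule eq_matI, goal_cases)
  case (1 i j)
  have *: "mop C (\<lambda>k. if k = j then 1 else 0) i = C $$ (i, j)" if "C \<in> carrier_mat n n" for C
  proof -
    have "mop C (\<lambda>k. if k = j then 1 else 0) i = (\<Sum>k<n. if k = j then C $$ (i,k) else 0)"
      using that 1(1) assms(2) unfolding mop_def carrier_mat_def by (auto simp: if_distrib[of "(*) _"] cong: if_cong)
    also have "\<dots> = C $$ (i, j)" using 1 assms by (subst sum.delta) auto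
    finally show ?thesis .
  qed
  show ?case by (simp only: *[OF assms(1), symmetric] *[OF assms(2), symmetric] assms(3))
qed (use assms in auto)

lemma serre_iff:
  assumes "x \<in> carrier_mat n n" "y \<in> carrier_mat n n"
  shows "serre q x y \<longleftrightarrow> (\<forall>f i. mop x (mop x (mop x (mop y f))) i
    - (q^2 + 1 + inverse q ^ 2) * mop x (mop x (mop y (mop x f))) i
    + (q^2 + 1 + inverse q ^ 2) * mop x (mop y (mop x (mop x f))) i
    - mop y (mop x (mop x (mop x f))) i = 0)" (is "_ \<longleftrightarrow> ?R")
proof -
  have d: "dim_row x = n" "dim_col x = n" "dim_row y = n" "dim_col y = n" using assms by auto
  let ?S = "x * x * x * y - (q^2 + 1 + inverse q ^ 2) \<cdot>\<^sub>m (x * x * y * x)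
       + (q^2 + 1 + inverse q ^ 2) \<cdot>\<^sub>m (x * y * x * x) - y * x * x * x"
  have S: "?S \<in> carrier_mat n n" using assms by auto
  have m: "mop ?S f = (\<lambda>i. mop x (mop x (mop x (mop y f))) i
    - (q^2 + 1 + inverse q ^ 2) * mop x (mop x (mop y (mop x f))) i
    + (q^2 + 1 + inverse q ^ 2) * mop x (mop y (mop x (mop x f))) i
    - mop y (mop x (mop x (mop x f))) i)" for f
    using d by (simp add: mop_add mop_smult mop_mult)
  show ?thesis
  proof
    assume "serre q x y"
    then have S0: "?S = 0\<^sub>m n n" unfolding serre_def d .
    show ?R
    proof (intro allI)
      fix f i
      from fun_cong[OF m[of f, unfolded S0 mop_zero], of i, symmetric]
      show "mop x (mop x (mop x (mop y f))) i
        - (q^2 + 1 + inverse q ^ 2) * mop x (mop x (mop y (mop x f))) i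
        + (q^2 + 1 + inverse q ^ 2) * mop x (mop y (mop x (mop x f))) i
        - mop y (mop x (mop x (mop x f))) i = 0" .
    qed
  next
    assume R: ?R
    have "mop ?S f = mop (0\<^sub>m n n) f" for f
      unfolding m mop_zero using R by (intro ext) simp
    then show "serre q x y"
      unfolding serre_def d by (intro mop_inject[OF S]) auto
  qed
qed

lemma serre_sum:
  assumes car: "X \<in> carrier_mat n n" "X' \<in> carrier_mat n n" "Y \<in> carrier_mat n n" "Y' \<in> carrier_mat n n"
    and SX: "serre q X X'" and SY: "serre q Y Y'"
    and cd: "c * d = 1" "c + d = q^2 + inverse q ^ 2"
    and r1: "Y * X = c \<cdot>\<^sub>m (X * Y)" and r2: "Y * X' = d \<cdot>\<^sub>m (X' * Y)" and r3: "Y' * X = d \<cdot>\<^sub>m (X * Y')"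
  shows "serre q (X + Y) (X' + Y')"
proof -
  have q: "q^2 + 1 + inverse q ^ 2 = c + d + 1" using cd by simp
  have d: "dim_row X = n" "dim_row Y = n" "dim_row X' = n" "dim_row Y' = n" 
     "dim_col X = n" "dim_col Y = n" "dim_col X' = n" "dim_col Y' = n" using car by auto
  have m: "mop Y (mop X f) = (\<lambda>i. c * mop X (mop Y f) i)" 
     "mop Y (mop X' f) = (\<lambda>i. d * mop X' (mop Y f) i)"
     "mop Y' (mop X f) = (\<lambda>i. d * mop X (mop Y' f) i)" for f
    using r1 r2 r3 by (simp_all add: mop_mult[symmetric] mop_smult[symmetric] d)
  have cd': "c * (d * z) = z" for z using cd(1) by (simp add: mult.assoc[symmetric])
  from SX SY have S: "mop X (mop X (mop X (mop X' f))) i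
    = (c+d+1) * mop X (mop X (mop X' (mop X f))) i
    - (c+d+1) * mop X (mop X' (mop X (mop X f))) i
    + mop X' (mop X (mop X (mop X f))) i" 
    "mop Y (mop Y (mop Y (mop Y' f))) i
    = (c+d+1) * mop Y (mop Y (mop Y' (mop Y f))) i
    - (c+d+1) * mop Y (mop Y' (mop Y (mop Y f))) i
    + mop Y' (mop Y (mop Y (mop Y f))) i" for f i
    unfolding serre_iff[OF car(1,2)] serre_iff[OF car(3,4)] q 
    by (simp_all add: algebra_simps)
  have c: "X + Y \<in> carrier_mat n n" "X' + Y' \<in> carrier_mat n n" using car by auto
  show ?thesis unfolding serre_iff[OF c] q
    by (intro allI, simp only: mop_add d mop_lin m S)
      (simp add: algebra_simps cd(1) cd')
qed


lemma conj_commute: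
  fixes K L X :: "complex mat"
  assumes "K \<in> carrier_mat n n" "L \<in> carrier_mat n n" "X \<in> carrier_mat n n"
    and "K * L = 1\<^sub>m n" "L * K = 1\<^sub>m n" "K * X * L = s \<cdot>\<^sub>m X"
  shows "K * X = s \<cdot>\<^sub>m (X * K)" "X * L = s \<cdot>\<^sub>m (L * X)"
proof -
  note c = assms(1-3)
  have "s \<cdot>\<^sub>m (X * K) = (K * X * L) * K" using c by (simp add: assms(6) mult_smult_assoc_mat[OF c(3) c(1)])
  also have "\<dots> = K * X * (L * K)" by (rule assoc_mult_mat) (use c in auto)
  also have "\<dots> = K * X" unfolding assms(5) by (rule right_mult_one_mat) (use c in auto)
  finally show "K * X = s \<cdot>\<^sub>m (X * K)" ..
  have "s \<cdot>\<^sub>m (L * X) = L * (K * X * L)" using c by (simp add: assms(6) mult_smult_distrib[OF c(2) c(3)])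
  also have "K * X * L = K * (X * L)" by (rule assoc_mult_mat) (use c in auto)
  also have "L * (K * (X * L)) = L * K * (X * L)" by (rule assoc_mult_mat[symmetric]) (use c in auto)
  also have "\<dots> = X * L" unfolding assms(5) by (rule left_mult_one_mat) (use c in auto)
  finally show "X * L = s \<cdot>\<^sub>m (L * X)" ..
qed

lemma smult_cancel:
  assumes "X = s \<cdot>\<^sub>m Y" "t * s = (1::complex)"
  shows "Y = t \<cdot>\<^sub>m X"
  unfolding assms(1) by (rule eq_matI) (simp_all add: assms(2) mult.assoc[symmetric])

lemma kron_conj:
  assumes "K \<in> carrier_mat m m" "L \<in> carrier_mat m m" "K' \<in> carrier_mat n n" "L' \<in> carrier_mat n n"
    "A \<in> carrier_mat m m" "B \<in> carrier_mat n n" "C \<in> carrier_mat m m" "D \<in> carrier_mat n n"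
  shows "(K \<otimes>\<^sub>m K') * (A \<otimes>\<^sub>m B + C \<otimes>\<^sub>m D) * (L \<otimes>\<^sub>m L') =
    (K * A * L) \<otimes>\<^sub>m (K' * B * L') + (K * C * L) \<otimes>\<^sub>m (K' * D * L')"
proof -
  have "(K \<otimes>\<^sub>m K') * (A \<otimes>\<^sub>m B + C \<otimes>\<^sub>m D) = (K * A) \<otimes>\<^sub>m (K' * B) + (K * C) \<otimes>\<^sub>m (K' * D)"
    by (subst mult_add_distrib_mat[of _ "m * n" "m * n" _ "m * n"])
      (use assms in \<open>auto intro!: kron_carrier simp: kron_mult[of _ m _ _ n]\<close>)
  also have "\<dots> * (L \<otimes>\<^sub>m L') = (K * A * L) \<otimes>\<^sub>m (K' * B * L') + (K * C * L) \<otimes>\<^sub>m (K' * D * L')"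
    by (subst add_mult_distrib_mat[of _ "m * n" "m * n" _ _ "m * n"])
      (use assms in \<open>auto intro!: kron_carrier simp: kron_mult[of _ m _ _ n]\<close>)
  finally show ?thesis .
qed

lemma mat_binomial:
  assumes "X \<in> carrier_mat n n" "Y \<in> carrier_mat n n" "Z \<in> carrier_mat n n" "W \<in> carrier_mat n n"
  shows "(X + Y) * (Z + W) = (X * Z + X * W) + (Y * Z + Y * W :: complex mat)"
  by (subst add_mult_distrib_mat[of _ n n])
    (use assms in \<open>auto simp: mult_add_distrib_mat[of _ n n]\<close>)

lemma kron_commutator:
  assumes car: "A \<in> carrier_mat m m" "R \<in> carrier_mat m m" "C \<in> carrier_mat m m"
    "P \<in> carrier_mat n n" "B \<in> carrier_mat n n" "D \<in> carrier_mat n n"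
    and AR: "A * R = s \<cdot>\<^sub>m (R * A)" and DP: "D * P = s \<cdot>\<^sub>m (P * D)"
  shows "(A \<otimes>\<^sub>m P + 1\<^sub>m m \<otimes>\<^sub>m B) * (C \<otimes>\<^sub>m 1\<^sub>m n + R \<otimes>\<^sub>m D)
      - (C \<otimes>\<^sub>m 1\<^sub>m n + R \<otimes>\<^sub>m D) * (A \<otimes>\<^sub>m P + 1\<^sub>m m \<otimes>\<^sub>m B)
    = (A * C - C * A) \<otimes>\<^sub>m P + R \<otimes>\<^sub>m (B * D - D * B)"
proof -
  note i = kron_carrier one_carrier_mat car mult_carrier_mat[of _ m m _ m] mult_carrier_mat[of _ n n _ n]
  have 1: "(A \<otimes>\<^sub>m P + 1\<^sub>m m \<otimes>\<^sub>m B) * (C \<otimes>\<^sub>m 1\<^sub>m n + R \<otimes>\<^sub>m D) =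
      (A * C) \<otimes>\<^sub>m P + (A * R) \<otimes>\<^sub>m (P * D) + (C \<otimes>\<^sub>m B + R \<otimes>\<^sub>m (B * D))"
    by (subst mat_binomial[of _ "m * n"]) (use car in \<open>auto intro!: kron_carrier simp: kron_mult[of _ m _ _ n]\<close>)
  have 2: "(C \<otimes>\<^sub>m 1\<^sub>m n + R \<otimes>\<^sub>m D) * (A \<otimes>\<^sub>m P + 1\<^sub>m m \<otimes>\<^sub>m B) =
      (C * A) \<otimes>\<^sub>m P + C \<otimes>\<^sub>m B + ((R * A) \<otimes>\<^sub>m (D * P) + R \<otimes>\<^sub>m (D * B))"
    by (subst mat_binomial[of _ "m * n"]) (use car in \<open>auto intro!: kron_carrier simp: kron_mult[of _ m _ _ n]\<close>)
  have 3: "(A * R) \<otimes>\<^sub>m (P * D) = (R * A) \<otimes>\<^sub>m (D * P)"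
    by (simp add: AR DP kron_smult)
  have 4: "(A * C - C * A) \<otimes>\<^sub>m P = (A * C) \<otimes>\<^sub>m P - (C * A) \<otimes>\<^sub>m P"
    "R \<otimes>\<^sub>m (B * D - D * B) = R \<otimes>\<^sub>m (B * D) - R \<otimes>\<^sub>m (D * B)"
    by (rule kron_lin(2)[of _ m _ _ n] kron_lin(4)[of _ n _ _ m]; use car in auto)+
  show ?thesis unfolding 1 2 3 4
    using car by (intro eq_matI) auto
qed


lemma commuting_words:
  assumes B: "B \<in> carrier_mat n n" and B': "B' \<in> carrier_mat n n" and comm: "B * B' = B' * B"
  shows "B * B * B' * B = B * B * B * B'" "B * B' * B * B = B * B * B * B'"
    "B' * B * B * B = B * B * B * B'"
proof -
  have swap: "P * B' * B = P * B * B'" if "P \<in> carrier_mat n n" for P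
    using assoc_mult_mat[OF that B B'] assoc_mult_mat[OF that B' B] comm by simp
  show 1: "B * B * B' * B = B * B * B * B'" by (rule swap) (use B in simp)
  then show 2: "B * B' * B * B = B * B * B * B'" by (simp only: swap[OF B])
  then show "B' * B * B * B = B * B * B * B'" by (simp only: comm)
qed

lemma kron_mult4:
  assumes "A \<in> carrier_mat m m" "B \<in> carrier_mat m m" "C \<in> carrier_mat m m" "D \<in> carrier_mat m m"
    "P \<in> carrier_mat n n" "Q \<in> carrier_mat n n" "R \<in> carrier_mat n n" "S \<in> carrier_mat n n"
  shows "(A \<otimes>\<^sub>m P) * (B \<otimes>\<^sub>m Q) * (C \<otimes>\<^sub>m R) * (D \<otimes>\<^sub>m S) = (A * B * C * D) \<otimes>\<^sub>m (P * Q * R * S)"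
  by (simp only: kron_mult[OF assms(1,2,5,6)]
      kron_mult[OF mult_carrier_mat[OF assms(1,2)] assms(3) mult_carrier_mat[OF assms(5,6)] assms(7)]
      kron_mult[OF mult_carrier_mat[OF mult_carrier_mat[OF assms(1,2)] assms(3)] assms(4)
        mult_carrier_mat[OF mult_carrier_mat[OF assms(5,6)] assms(7)] assms(8)])

lemma serre_kron1:
  assumes "A \<in> carrier_mat m m" "A' \<in> carrier_mat m m" "B \<in> carrier_mat n n" "B' \<in> carrier_mat n n"
    and S: "serre q A A'" and comm: "B * B' = B' * B"
  shows "serre q (A \<otimes>\<^sub>m B) (A' \<otimes>\<^sub>m B')"
proof -
  let ?Q = "B * B * B * B'" and ?b = "q^2 + 1 + inverse q ^ 2"
  have Q: "B * B * B' * B = ?Q" "B * B' * B * B = ?Q" "B' * B * B * B = ?Q"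
    by (rule commuting_words[OF assms(3) assms(4) comm])+
  have c: "A * A * A * A' \<in> carrier_mat m m" "A * A * A' * A \<in> carrier_mat m m"
    "A * A' * A * A \<in> carrier_mat m m" "A' * A * A * A \<in> carrier_mat m m" "?Q \<in> carrier_mat n n"
    using assms(1-4) by auto
  have d: "dim_row A = m" using assms(1) by auto
  have S': "A * A * A * A' - ?b \<cdot>\<^sub>m (A * A * A' * A) + ?b \<cdot>\<^sub>m (A * A' * A * A) - A' * A * A * A
      = 0\<^sub>m m m" using S unfolding serre_def d .
  have "(A * A * A * A') \<otimes>\<^sub>m ?Q - ?b \<cdot>\<^sub>m ((A * A * A' * A) \<otimes>\<^sub>m ?Q) + ?b \<cdot>\<^sub>m ((A * A' * A * A) \<otimes>\<^sub>m ?Q)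
      - (A' * A * A * A) \<otimes>\<^sub>m ?Q =
    (A * A * A * A' - ?b \<cdot>\<^sub>m (A * A * A' * A) + ?b \<cdot>\<^sub>m (A * A' * A * A) - A' * A * A * A) \<otimes>\<^sub>m ?Q"
    using c by (simp add: kron_lin[of _ m _ _ n] kron_smult minus_carrier_mat)
  also have "\<dots> = 0\<^sub>m (m * n) (m * n)" unfolding S' by (rule kron_zero(2)[OF c(5)])
  finally show ?thesis unfolding serre_def
      kron_mult4[OF assms(1,1,1,2,3,3,3,4)] kron_mult4[OF assms(1,1,2,1,3,3,4,3)]
      kron_mult4[OF assms(1,2,1,1,3,4,3,3)] kron_mult4[OF assms(2,1,1,1,4,3,3,3)] Q
      kron_dim carrier_matD(1)[OF assms(1)] carrier_matD(1)[OF assms(3)] .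
qed

lemma serre_kron2:
  assumes "A \<in> carrier_mat m m" "A' \<in> carrier_mat m m" "B \<in> carrier_mat n n" "B' \<in> carrier_mat n n"
    and S: "serre q B B'" and comm: "A * A' = A' * A"
  shows "serre q (A \<otimes>\<^sub>m B) (A' \<otimes>\<^sub>m B')"
proof -
  let ?Q = "A * A * A * A'" and ?b = "q^2 + 1 + inverse q ^ 2"
  have Q: "A * A * A' * A = ?Q" "A * A' * A * A = ?Q" "A' * A * A * A = ?Q"
    by (rule commuting_words[OF assms(1) assms(2) comm])+
  have c: "B * B * B * B' \<in> carrier_mat n n" "B * B * B' * B \<in> carrier_mat n n"
    "B * B' * B * B \<in> carrier_mat n n" "B' * B * B * B \<in> carrier_mat n n" "?Q \<in> carrier_mat m m"
    using assms(1-4) by auto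
  have d: "dim_row B = n" using assms(3) by auto
  have S': "B * B * B * B' - ?b \<cdot>\<^sub>m (B * B * B' * B) + ?b \<cdot>\<^sub>m (B * B' * B * B) - B' * B * B * B
      = 0\<^sub>m n n" using S unfolding serre_def d .
  have "?Q \<otimes>\<^sub>m (B * B * B * B') - ?b \<cdot>\<^sub>m (?Q \<otimes>\<^sub>m (B * B * B' * B)) + ?b \<cdot>\<^sub>m (?Q \<otimes>\<^sub>m (B * B' * B * B))
      - ?Q \<otimes>\<^sub>m (B' * B * B * B) =
    ?Q \<otimes>\<^sub>m (B * B * B * B' - ?b \<cdot>\<^sub>m (B * B * B' * B) + ?b \<cdot>\<^sub>m (B * B' * B * B) - B' * B * B * B)"
    using c by (simp add: kron_lin[of _ n _ _ m] kron_smult minus_carrier_mat)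
  also have "\<dots> = 0\<^sub>m (m * n) (m * n)" unfolding S' by (rule kron_zero(1)[OF c(5)])
  finally show ?thesis unfolding serre_def
      kron_mult4[OF assms(1,1,1,2,3,3,3,4)] kron_mult4[OF assms(1,1,2,1,3,3,4,3)]
      kron_mult4[OF assms(1,2,1,1,3,4,3,3)] kron_mult4[OF assms(2,1,1,1,4,3,3,3)] Q
      kron_dim carrier_matD(1)[OF assms(1)] carrier_matD(1)[OF assms(3)] .
qed

lemma U_moduleD:
  assumes "U_module q M"
  shows "act M g \<in> carrier_mat (udim M) (udim M)"
    "act M Kp * act M Km = 1\<^sub>m (udim M)" "act M Km * act M Kp = 1\<^sub>m (udim M)"
    "act M Kp * act M E1 * act M Km = q^2 \<cdot>\<^sub>m act M E1"
    "act M Kp * act M F1 * act M Km = (inverse q ^ 2) \<cdot>\<^sub>m act M F1"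
    "act M Kp * act M E0 * act M Km = (inverse q ^ 2) \<cdot>\<^sub>m act M E0"
    "act M Kp * act M F0 * act M Km = q^2 \<cdot>\<^sub>m act M F0"
    "act M E1 * act M F1 - act M F1 * act M E1
      = (1 / (q - inverse q)) \<cdot>\<^sub>m (act M Kp - act M Km)"
    "- (act M E0 * act M F0 - act M F0 * act M E0)
      = (1 / (q - inverse q)) \<cdot>\<^sub>m (act M Kp - act M Km)"
    "act M E1 * act M F0 - act M F0 * act M E1 = 0\<^sub>m (udim M) (udim M)"
    "act M E0 * act M F1 - act M F1 * act M E0 = 0\<^sub>m (udim M) (udim M)"
    "serre q (act M E0) (act M E1)" "serre q (act M E1) (act M E0)"
    "serre q (act M F0) (act M F1)" "serre q (act M F1) (act M F0)"
  using assms unfolding U_module_def by blast+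

lemma U_module_commute:
  assumes M: "U_module q M" and q: "q \<noteq> 0"
  shows "act M Kp * act M E1 = q^2 \<cdot>\<^sub>m (act M E1 * act M Kp)"
    "act M E1 * act M Km = q^2 \<cdot>\<^sub>m (act M Km * act M E1)"
    "act M Kp * act M F1 = (inverse q ^ 2) \<cdot>\<^sub>m (act M F1 * act M Kp)"
    "act M F1 * act M Km = (inverse q ^ 2) \<cdot>\<^sub>m (act M Km * act M F1)"
    "act M Kp * act M E0 = (inverse q ^ 2) \<cdot>\<^sub>m (act M E0 * act M Kp)"
    "act M E0 * act M Km = (inverse q ^ 2) \<cdot>\<^sub>m (act M Km * act M E0)"
    "act M Kp * act M F0 = q^2 \<cdot>\<^sub>m (act M F0 * act M Kp)"
    "act M F0 * act M Km = q^2 \<cdot>\<^sub>m (act M Km * act M F0)"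
    "act M E1 * act M Kp = (inverse q ^ 2) \<cdot>\<^sub>m (act M Kp * act M E1)"
    "act M Km * act M E1 = (inverse q ^ 2) \<cdot>\<^sub>m (act M E1 * act M Km)"
    "act M F1 * act M Kp = q^2 \<cdot>\<^sub>m (act M Kp * act M F1)"
    "act M Km * act M F1 = q^2 \<cdot>\<^sub>m (act M F1 * act M Km)"
    "act M E0 * act M Kp = q^2 \<cdot>\<^sub>m (act M Kp * act M E0)"
    "act M Km * act M E0 = q^2 \<cdot>\<^sub>m (act M E0 * act M Km)"
    "act M F0 * act M Kp = (inverse q ^ 2) \<cdot>\<^sub>m (act M Kp * act M F0)"
    "act M Km * act M F0 = (inverse q ^ 2) \<cdot>\<^sub>m (act M F0 * act M Km)"
proof -
  note D = U_moduleD[OF M]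
  note c = conj_commute[OF D(1) D(1) D(1) D(2) D(3)]
  show 1: "act M Kp * act M E1 = q^2 \<cdot>\<^sub>m (act M E1 * act M Kp)"
    "act M E1 * act M Km = q^2 \<cdot>\<^sub>m (act M Km * act M E1)"
    "act M Kp * act M F1 = (inverse q ^ 2) \<cdot>\<^sub>m (act M F1 * act M Kp)"
    "act M F1 * act M Km = (inverse q ^ 2) \<cdot>\<^sub>m (act M Km * act M F1)"
    "act M Kp * act M E0 = (inverse q ^ 2) \<cdot>\<^sub>m (act M E0 * act M Kp)"
    "act M E0 * act M Km = (inverse q ^ 2) \<cdot>\<^sub>m (act M Km * act M E0)"
    "act M Kp * act M F0 = q^2 \<cdot>\<^sub>m (act M F0 * act M Kp)"
    "act M F0 * act M Km = q^2 \<cdot>\<^sub>m (act M Km * act M F0)"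
    using D(4-7)[THEN c(1)] D(4-7)[THEN c(2)] by simp_all
  have e: "inverse q ^ 2 * q^2 = 1" "q^2 * inverse q ^ 2 = 1"
    using q by (simp_all add: power_mult_distrib[symmetric])
  show "act M E1 * act M Kp = (inverse q ^ 2) \<cdot>\<^sub>m (act M Kp * act M E1)"
    "act M Km * act M E1 = (inverse q ^ 2) \<cdot>\<^sub>m (act M E1 * act M Km)"
    "act M F1 * act M Kp = q^2 \<cdot>\<^sub>m (act M Kp * act M F1)"
    "act M Km * act M F1 = q^2 \<cdot>\<^sub>m (act M F1 * act M Km)"
    "act M E0 * act M Kp = q^2 \<cdot>\<^sub>m (act M Kp * act M E0)"
    "act M Km * act M E0 = q^2 \<cdot>\<^sub>m (act M E0 * act M Km)"
    "act M F0 * act M Kp = (inverse q ^ 2) \<cdot>\<^sub>m (act M Kp * act M F0)"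
    "act M Km * act M F0 = (inverse q ^ 2) \<cdot>\<^sub>m (act M F0 * act M Km)"
    by (rule smult_cancel, fact 1, fact e)+
qed

theorem U_module_tensor:
  assumes M: "U_module q M" and N: "U_module q N" and q: "q \<noteq> 0"
  shows "U_module q (tensor M N)"
proof -
  let ?m = "udim M" and ?n = "udim N" and ?T = "tensor M N"
  note DM = U_moduleD[OF M] and DN = U_moduleD[OF N]
  note CM = U_module_commute[OF M q] and CN = U_module_commute[OF N q]
  have d: "udim ?T = ?m * ?n" and a: "act ?T = tensor_act M N"
    by (simp_all add: tensor_def)
  have one: "1\<^sub>m ?m \<in> carrier_mat ?m ?m" "1\<^sub>m ?n \<in> carrier_mat ?n ?n" by auto
  have c: "act ?T g \<in> carrier_mat (?m * ?n) (?m * ?n)" for g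
    unfolding a
    by (cases g; simp only: tensor_act.simps; intro add_carrier_mat kron_carrier one DM(1) DN(1))
  have e: "inverse q ^ 2 * q^2 = 1" "q^2 * inverse q ^ 2 = 1"
    using q by (simp_all add: power_mult_distrib[symmetric])
  have KKL: "act M Kp * act M Kp * act M Km = act M Kp" "act N Kp * act N Kp * act N Km = act N Kp"
    "act M Kp * act M Km * act M Km = act M Km" "act N Kp * act N Km * act N Km = act N Km"
    "act M Kp * 1\<^sub>m ?m * act M Km = 1\<^sub>m ?m" "act N Kp * 1\<^sub>m ?n * act N Km = 1\<^sub>m ?n"
    using assoc_mult_mat[OF DM(1,1,1)] assoc_mult_mat[OF DN(1,1,1)]
    by (simp_all add: DM(2) DN(2) right_mult_one_mat[OF DM(1)] right_mult_one_mat[OF DN(1)]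
          left_mult_one_mat[OF DM(1)] left_mult_one_mat[OF DN(1)])
  have K1: "act ?T Kp * act ?T Km = 1\<^sub>m (?m * ?n)" "act ?T Km * act ?T Kp = 1\<^sub>m (?m * ?n)"
    by (simp_all add: a kron_mult[OF DM(1) DM(1) DN(1) DN(1)] DM(2,3) DN(2,3) kron_one)
  note kc = kron_conj[OF DM(1) DM(1) DN(1) DN(1)]
  have sm: "s \<cdot>\<^sub>m X + s \<cdot>\<^sub>m Y = s \<cdot>\<^sub>m (X + Y)"
    if "X \<in> carrier_mat (?m * ?n) (?m * ?n)" "Y \<in> carrier_mat (?m * ?n) (?m * ?n)"
    for s :: complex and X Y
    using add_smult_distrib_left_mat[OF that] by simp
  have K2: "act ?T Kp * act ?T E1 * act ?T Km = q^2 \<cdot>\<^sub>m act ?T E1"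
    "act ?T Kp * act ?T F1 * act ?T Km = (inverse q ^ 2) \<cdot>\<^sub>m act ?T F1"
    "act ?T Kp * act ?T E0 * act ?T Km = (inverse q ^ 2) \<cdot>\<^sub>m act ?T E0"
    "act ?T Kp * act ?T F0 * act ?T Km = q^2 \<cdot>\<^sub>m act ?T F0"
    unfolding a tensor_act.simps
      kc[OF DM(1) DN(1) one(1) DN(1)] kc[OF DM(1) one(2) DM(1) DN(1)] KKL DM(4-7) DN(4-7) kron_smult
    by (rule sm; intro kron_carrier one DM(1) DN(1))+
  have C: "act ?T E1 * act ?T F1 - act ?T F1 * act ?T E1 =
      (act M E1 * act M F1 - act M F1 * act M E1) \<otimes>\<^sub>m act N Kp
      + act M Km \<otimes>\<^sub>m (act N E1 * act N F1 - act N F1 * act N E1)"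
    "act ?T E0 * act ?T F0 - act ?T F0 * act ?T E0 =
      (act M E0 * act M F0 - act M F0 * act M E0) \<otimes>\<^sub>m act N Km
      + act M Kp \<otimes>\<^sub>m (act N E0 * act N F0 - act N F0 * act N E0)"
    "act ?T E1 * act ?T F0 - act ?T F0 * act ?T E1 =
      (act M E1 * act M F0 - act M F0 * act M E1) \<otimes>\<^sub>m act N Kp
      + act M Kp \<otimes>\<^sub>m (act N E1 * act N F0 - act N F0 * act N E1)"
    "act ?T E0 * act ?T F1 - act ?T F1 * act ?T E0 =
      (act M E0 * act M F1 - act M F1 * act M E0) \<otimes>\<^sub>m act N Km
      + act M Km \<otimes>\<^sub>m (act N E0 * act N F1 - act N F1 * act N E0)"
    unfolding a tensor_act.simps
    by (rule kron_commutator; (rule DM(1) DN(1) CM CN)+)+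
  let ?z = "1 / (q - inverse q)"
  have uminus: "X = (- s) \<cdot>\<^sub>m Y" if "- X = s \<cdot>\<^sub>m Y" for X Y :: "complex mat" and s
  proof -
    have "X = - (- X)" by (rule eq_matI) simp_all
    also have "\<dots> = (- s) \<cdot>\<^sub>m Y" unfolding that by (rule eq_matI) simp_all
    finally show ?thesis .
  qed
  have KT: "act ?T Kp = act M Kp \<otimes>\<^sub>m act N Kp" "act ?T Km = act M Km \<otimes>\<^sub>m act N Km"
    by (simp_all add: a)
  note kl = kron_lin(2)[OF DM(1) DM(1) DN(1)] kron_lin(4)[OF DN(1) DN(1) DM(1)]
  have C1: "act ?T E1 * act ?T F1 - act ?T F1 * act ?T E1 = ?z \<cdot>\<^sub>m (act ?T Kp - act ?T Km)"
    unfolding C DM(8) DN(8) kron_smult KT kl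
    by (rule eq_matI; simp add: carrier_matD[OF DM(1)] carrier_matD[OF DN(1)] ring_distribs
          diff_divide_distrib)
  have C2: "act ?T E0 * act ?T F0 - act ?T F0 * act ?T E0 = (- ?z) \<cdot>\<^sub>m (act ?T Kp - act ?T Km)"
    unfolding C DM(9)[THEN uminus] DN(9)[THEN uminus] kron_smult KT kl
    by (rule eq_matI; simp add: carrier_matD[OF DM(1)] carrier_matD[OF DN(1)] ring_distribs
          diff_divide_distrib)
  have C2': "- (act ?T E0 * act ?T F0 - act ?T F0 * act ?T E0) = ?z \<cdot>\<^sub>m (act ?T Kp - act ?T Km)"
    unfolding C2 by (rule eq_matI) simp_all
  have C3: "act ?T E1 * act ?T F0 - act ?T F0 * act ?T E1 = 0\<^sub>m (?m * ?n) (?m * ?n)"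
    "act ?T E0 * act ?T F1 - act ?T F1 * act ?T E0 = 0\<^sub>m (?m * ?n) (?m * ?n)"
    unfolding C DM(10,11) DN(10,11) kron_zero[OF DM(1)] kron_zero[OF DN(1)] by simp_all
  have m: "(A \<otimes>\<^sub>m B) * (C \<otimes>\<^sub>m D) = s \<cdot>\<^sub>m ((C \<otimes>\<^sub>m D) * (A \<otimes>\<^sub>m B))"
    if "A \<in> carrier_mat ?m ?m" "B \<in> carrier_mat ?n ?n" "C \<in> carrier_mat ?m ?m" "D \<in> carrier_mat ?n ?n"
      "(A * C) \<otimes>\<^sub>m (B * D) = s \<cdot>\<^sub>m ((C * A) \<otimes>\<^sub>m (D * B))"
    for A B C D s
    using that by (simp add: kron_mult[of _ ?m _ _ ?n])
  have KL: "act M Kp * act M Km = act M Km * act M Kp" "act N Kp * act N Km = act N Km * act N Kp"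
    by (simp_all only: DM(2,3) DN(2,3))
  note ones = left_mult_one_mat[OF DM(1)] left_mult_one_mat[OF DN(1)]
    right_mult_one_mat[OF DM(1)] right_mult_one_mat[OF DN(1)]
  note kc1 = kron_carrier[OF DM(1) DN(1)] kron_carrier[OF one(1) DN(1)] kron_carrier[OF DM(1) one(2)]
  have ss: "inverse q ^ 2 \<cdot>\<^sub>m (q^2 \<cdot>\<^sub>m X) = X" "q^2 \<cdot>\<^sub>m (inverse q ^ 2 \<cdot>\<^sub>m X) = X"
    for X :: "complex mat"
    by (rule smult_cancel[symmetric, OF refl]; fact e)+
  have cd: "q^2 + inverse q ^ 2 = q^2 + inverse q ^ 2" "inverse q ^ 2 + q^2 = q^2 + inverse q ^ 2"
    by simp_all
  note serre1 = serre_kron1[OF DM(1) DM(1) DN(1) DN(1)] serre_kron1[OF DM(1) DM(1) one(2) one(2)]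
  note serre2 = serre_kron2[OF DM(1) DM(1) DN(1) DN(1)] serre_kron2[OF one(1) one(1) DN(1) DN(1)]
  have SE: "serre q (act ?T E0) (act ?T E1)" "serre q (act ?T E1) (act ?T E0)"
    unfolding a tensor_act.simps
    by (rule serre_sum[OF kc1(1) kc1(1) kc1(2) kc1(2) serre1(1) serre2(2) e(1) cd(2)];
        (rule DM DN KL KL[symmetric] refl
          | rule m, (rule DM(1) DN(1) one)+,
            simp only: ones CM(1,3,5,7,10,12,14,16) CN(1,3,5,7,10,12,14,16) kron_smult ss))+
  have SF: "serre q (act ?T F0) (act ?T F1)" "serre q (act ?T F1) (act ?T F0)"
    unfolding a tensor_act.simps
    by (rule serre_sum[OF kc1(3) kc1(3) kc1(1) kc1(1) serre1(2) serre2(1) e(2) cd(1)];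
        (rule DM DN KL KL[symmetric] refl
          | rule m, (rule DM(1) DN(1) one)+,
            simp only: ones CM(1,3,5,7,10,12,14,16) CN(1,3,5,7,10,12,14,16) kron_smult ss))+
  show ?thesis
    unfolding U_module_def d using c K1 K2 C1 C2' C3 SE SF by blast
qed


lemma U_module_trivial: "U_module q trivial_umod"
proof -
  have "act trivial_umod g \<in> carrier_mat 1 1" for g
    by (cases g) (simp_all add: trivial_umod_def)
  then show ?thesis
    by (auto simp: U_module_def serre_def trivial_umod_def intro!: eq_matI)
qed

lemma mat2_ops:
  fixes a b c d :: complex
  shows "mat_of_rows_list 2 [[a, b], [c, d]] * mat_of_rows_list 2 [[a', b'], [c', d']] =
    mat_of_rows_list 2 [[a * a' + b * c', a * b' + b * d'], [c * a' + d * c', c * b' + d * d']]"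
    "mat_of_rows_list 2 [[a, b], [c, d]] - mat_of_rows_list 2 [[a', b'], [c', d']] =
    mat_of_rows_list 2 [[a - a', b - b'], [c - c', d - d']]"
    "mat_of_rows_list 2 [[a, b], [c, d]] + mat_of_rows_list 2 [[a', b'], [c', d']] =
    mat_of_rows_list 2 [[a + a', b + b'], [c + c', d + d']]"
    "- mat_of_rows_list 2 [[a, b], [c, d]] = mat_of_rows_list 2 [[- a, - b], [- c, - d]]"
    "s \<cdot>\<^sub>m mat_of_rows_list 2 [[a, b], [c, d]] = mat_of_rows_list 2 [[s * a, s * b], [s * c, s * d]]"
    "1\<^sub>m 2 = mat_of_rows_list 2 [[1, 0], [0, 1 :: complex]]"
    "0\<^sub>m 2 2 = mat_of_rows_list 2 [[0, 0], [0, 0 :: complex]]"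
    "dim_row (mat_of_rows_list 2 [[a, b], [c, d]]) = 2"
  by (rule eq_matI | simp add: mat_of_rows_list_def; fail |
      auto simp: mat_of_rows_list_def scalar_prod_def numeral_2_eq_2 less_Suc_eq)+

lemma U_module_eval:
  assumes q: "q \<noteq> 0" "q^2 \<noteq> 1"
  shows "U_module q (eval_umod q a)"
proof -
  have z: "(q - inverse q) \<noteq> 0" using q by (auto simp: field_simps power2_eq_square)
  have z2: "(inverse q - q) / (q - inverse q) = -1"
    using z by (metis minus_diff_eq minus_divide_left divide_self)
  have p: "q powi (- a) * q powi a = 1" "q powi a * q powi (- a) = 1" 
    using q by (simp_all add: power_int_minus)
  have c: "act (eval_umod q a) g \<in> carrier_mat 2 2" for g
    by (cases g) (simp_all add: eval_umod_def mat_of_rows_list_def numeral_2_eq_2)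
  then have d: "dim_row (act (eval_umod q a) g) = 2" for g by auto
  have u: "udim (eval_umod q a) = 2" by (simp add: eval_umod_def)
  have "serre q (act (eval_umod q a) E0) (act (eval_umod q a) E1)"
    "serre q (act (eval_umod q a) E1) (act (eval_umod q a) E0)"
    "serre q (act (eval_umod q a) F0) (act (eval_umod q a) F1)"
    "serre q (act (eval_umod q a) F1) (act (eval_umod q a) F0)"
    by (simp_all add: serre_def eval_umod_def mat2_ops)
  then show ?thesis unfolding U_module_def u using c
    by (intro conjI allI; (assumption | simp add: eval_umod_def mat2_ops)?; use q z z2 p in
        \<open>(simp; fail) | simp add: field_simps power2_eq_square\<close>)
qed

theorem U_module_word:
  assumes "q \<noteq> 0" "q^2 \<noteq> 1"
  shows "U_module q (word_umod q w)"
  using assms by (induction w) (auto intro!: U_module_trivial U_module_tensor U_module_eval)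

lemma Hom_U_subspace:
  assumes M: "U_module q M" and N: "U_module q N"
  shows "subspace class_ring (Hom_U M N) (module_mat TYPE(complex) (udim N) (udim M))"
proof -
  note DM = U_moduleD(1)[OF M] and DN = U_moduleD(1)[OF N]
  have vs: "vectorspace (class_ring :: complex ring) (module_mat TYPE(complex) (udim N) (udim M))"
    by (rule matrix_vs)
  have add: "X + Y \<in> Hom_U M N" if "X \<in> Hom_U M N" "Y \<in> Hom_U M N" for X Y
  proof -
    from that have c: "X \<in> carrier_mat (udim N) (udim M)" "Y \<in> carrier_mat (udim N) (udim M)"
      and "X * act M g = act N g * X" "Y * act M g = act N g * Y" for g
      by (auto simp: Hom_U_def)
    then have "(X + Y) * act M g = act N g * (X + Y)" for g
      by (simp only: add_mult_distrib_mat[OF c DM] mult_add_distrib_mat[OF DN c])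
    with c show ?thesis by (simp add: Hom_U_def)
  qed
  have smult: "s \<cdot>\<^sub>m X \<in> Hom_U M N" if "X \<in> Hom_U M N" for s X
  proof -
    from that have c: "X \<in> carrier_mat (udim N) (udim M)" and "X * act M g = act N g * X" for g
      by (auto simp: Hom_U_def)
    then have "(s \<cdot>\<^sub>m X) * act M g = act N g * (s \<cdot>\<^sub>m X)" for g
      by (simp only: mult_smult_assoc_mat[OF c DM] mult_smult_distrib[OF DN c])
    with c show ?thesis by (simp add: Hom_U_def)
  qed
  have zero: "0\<^sub>m (udim N) (udim M) \<in> Hom_U M N"
    by (simp add: Hom_U_def left_mult_zero_mat[OF DM] right_mult_zero_mat[OF DN])
  show ?thesis
  proof (rule subspace.intro[OF vs], rule submodule.intro)
    show "Module.module (class_ring :: complex ring) (module_mat TYPE(complex) (udim N) (udim M))"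
      using vs by (simp add: vectorspace_def)
  qed (use add smult zero in \<open>auto simp: module_mat_simps Hom_U_def\<close>)
qed

end

theory Submission
  imports Defs "HOL-Library.List_Lexorder"
begin

text \<open>
  Write \<open>+\<close> at the left end and \<open>-\<close> at the right end of every arc.  In an irreducible
  configuration arcs with the same left letter do not cross, so the configuration can be recovered from
  its sign pattern.  Hence it suffices to find, for every irreducible configuration, an invariant
  vector whose lexicographically largest basis vector (with \<open>- < +\<close>) is the sign pattern: these
  vectors are linearly independent.

  The vector is built by inserting the arcs from the last right end to the first.  When the arc
  from \<open>a\<close> to \<open>a + 2\<close> is inserted, all letters between its ends are still left ends of open arcs.
  Insert the invariant of \<open>a \<otimes> (a + 2)\<close> at the place of \<open>a\<close> and move the letter \<open>a + 2\<close>
  to the right by R-matrices \<open>c \<otimes> b \<rightarrow> b \<otimes> c\<close>.  These may be degenerate, but the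
  coefficient carrying \<open>- +\<close> to \<open>+ -\<close> is a multiple of \<open>q powi c - q powi b\<close>, and \<open>b \<noteq> c = a + 2\<close>
  by irreducibility; so the leading term survives.
\<close>

section \<open>Linear algebra\<close>

text \<open>Independent subsets of \<open>W\<close> remain independent in \<open>V\<close>, so their
  size is bounded by \<open>dim\<close>; one that is maximal is a finite basis of
  \<open>W\<close>.\<close>

lemma (in vectorspace) fin_dim_subspace:
  assumes fd: "fin_dim" and W: "subspace K W V"
  shows "vectorspace.fin_dim K (V\<lparr>carrier := W\<rparr>)"
proof -
  interpret W: vectorspace K "V\<lparr>carrier := W\<rparr>" by (rule subspace_is_vs[OF W])
  have sub: "submodule K W V" using W by (simp add: subspace_def)
  have WV: "W \<subseteq> carrier V" using sub by (simp add: submodule_def)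
  have li: "finite A \<and> card A \<le> dim" if "A \<subseteq> W \<and> W.lin_indpt A" for A
    using li_le_dim[OF fd] span_li_not_depend(2)[OF _ sub, of A] that WV by blast
  have "{} \<subseteq> W \<and> W.lin_indpt {}" by (auto simp: W.lin_dep_def)
  then obtain A where A: "finite A" "maximal A (\<lambda>A. A \<subseteq> W \<and> W.lin_indpt A)"
    using maximal_exists[of "\<lambda>A. A \<subseteq> W \<and> W.lin_indpt A" dim "{}"] li by blast
  then have "W.basis A" by (intro W.max_li_is_basis) simp
  with A(1) show ?thesis unfolding W.fin_dim_def W.basis_def by blast
qed

text \<open>The space is the image of the space of vectors under the linear map that turns a vector
  into a one-column matrix.\<close>

lemma fin_dim_column_matrices:
  "vectorspace.fin_dim class_ring (module_mat TYPE('a::field) n 1)"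
proof -
  interpret C: vec_space "TYPE('a)" n .
  interpret M: matrix_vs n 1 "TYPE('a)" .
  interpret linear_map class_ring "module_vec TYPE('a) n" "module_mat TYPE('a) n 1"
      "\<lambda>v. mat_of_cols n [v]"
  proof (intro linear_map.intro mod_hom.intro mod_hom_axioms.intro)
    show "(\<lambda>v. mat_of_cols n [v]) \<in> LinearCombinations.module_hom class_ring (module_vec TYPE('a) n) (module_mat TYPE('a) n 1)"
      by (auto simp: LinearCombinations.module_hom_def module_vec_simps module_mat_simps mat_of_cols_def intro!: eq_matI)
  qed (unfold_locales)
  have "X \<in> (\<lambda>v. mat_of_cols n [v]) ` carrier_vec n" if "X \<in> carrier_mat n 1" for X :: "'a mat"
    by (rule image_eqI[of _ _ "col X 0"]) (use that in \<open>auto simp: mat_of_cols_def intro!: eq_matI\<close>)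
  then show ?thesis
    by (intro image_fin_dim) (auto simp: module_vec_simps module_mat_simps)
qed

lemma (in matrix_vs) lincomb_index:
  assumes "finite A" "A \<subseteq> carrier_mat nr nc" "i < nr" "j < nc"
  shows "lincomb c A $$ (i, j) = (\<Sum>X\<in>A. c X * X $$ (i, j))"
  using assms(1,2)
proof (induction A)
  case empty
  then show ?case using assms(3,4) by (simp add: lincomb_def)
next
  case (insert X A)
  then have "lincomb c (insert X A) = c X \<cdot>\<^sub>m X + lincomb c A"
    by (intro lincomb_insert2) auto
  moreover have "lincomb c A \<in> carrier_mat nr nc" using insert by (intro lincomb_closed) auto
  moreover have "X \<in> carrier_mat nr nc" using insert by auto
  ultimately show ?case
    using insert.hyps insert.IH insert.prems assms(3,4) by (simp del: lincomb_closed)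
qed

text \<open>Among the indices with nonzero coefficient take the one with the largest lead: at that
  lead all other terms of the combination vanish.\<close>

lemma triangular_independent:
  fixes c :: "'i \<Rightarrow> 'a::field" and f :: "'i \<Rightarrow> 's::linorder \<Rightarrow> 'a"
  assumes "finite I" "inj_on lead I"
    and nz: "\<And>i. i \<in> I \<Longrightarrow> f i (lead i) \<noteq> 0"
    and z: "\<And>i j. i \<in> I \<Longrightarrow> j \<in> I \<Longrightarrow> lead i < lead j \<Longrightarrow> f i (lead j) = 0"
    and comb: "\<And>j. j \<in> I \<Longrightarrow> (\<Sum>i\<in>I. c i * f i (lead j)) = 0"
    and "i \<in> I"
  shows "c i = 0"
proof (rule ccontr)
  assume "c i \<noteq> 0"
  let ?S = "{i\<in>I. c i \<noteq> 0}"
  have S: "finite (lead ` ?S)" "lead ` ?S \<noteq> {}" using assms \<open>c i \<noteq> 0\<close> by auto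
  obtain m where m: "m \<in> I" "c m \<noteq> 0" "lead m = Max (lead ` ?S)"
    using Max_in[OF S] by auto
  have "c k * f k (lead m) = 0" if k: "k \<in> I - {m}" for k
  proof (cases "c k = 0")
    case False
    then have "lead k \<le> lead m" using k m(3) S(1) by auto
    moreover have "lead k \<noteq> lead m" using k m(1) \<open>inj_on lead I\<close> by (auto dest: inj_onD)
    ultimately show ?thesis using z[of k m] k m(1) by auto
  qed simp
  then have "(\<Sum>i\<in>I. c i * f i (lead m)) = c m * f m (lead m)"
    using \<open>finite I\<close> m(1) by (simp add: sum.remove[of I m] sum.neutral)
  then show False using comb[OF m(1)] m(1,2) nz by auto
qed

section \<open>Intertwining operators\<close>

definition kweight :: "complex \<Rightarrow> bool \<Rightarrow> complex" where
  "kweight q b = (if b then q else inverse q)"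

fun counit :: "gen \<Rightarrow> complex" where
  "counit Kp = 1" | "counit Km = 1" | "counit _ = 0"

text \<open>
  A vector of the module of a word is a function on sign lists, \<open>True\<close> standing for \<open>v\<^sub>+\<close>; only
  its values on lists as long as the word matter.
\<close>

fun wact :: "complex \<Rightarrow> gen \<Rightarrow> int list \<Rightarrow> (bool list \<Rightarrow> complex) \<Rightarrow> bool list \<Rightarrow> complex" where
  "wact q g [] x z = counit g * x z"
| "wact q g (a # w) x [] = 0"
| "wact q Kp (a # w) x (b # z) = kweight q b * wact q Kp w (\<lambda>y. x (b # y)) z"
| "wact q Km (a # w) x (b # z) = inverse (kweight q b) * wact q Km w (\<lambda>y. x (b # y)) z"
| "wact q E1 (a # w) x (b # z) =
     (if b then wact q Kp w (\<lambda>y. x (False # y)) z else 0) + wact q E1 w (\<lambda>y. x (b # y)) z"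
| "wact q E0 (a # w) x (b # z) =
     (if b then 0 else q powi a * wact q Km w (\<lambda>y. x (True # y)) z) + wact q E0 w (\<lambda>y. x (b # y)) z"
| "wact q F1 (a # w) x (b # z) =
     (if b then 0 else x (True # z)) + inverse (kweight q b) * wact q F1 w (\<lambda>y. x (b # y)) z"
| "wact q F0 (a # w) x (b # z) =
     (if b then q powi (- a) * x (False # z) else 0) + kweight q b * wact q F0 w (\<lambda>y. x (b # y)) z"

text \<open>Such vectors are the images of 1 under homomorphisms from the trivial module;
  \<open>counit g\<close> is the scalar by which \<open>g\<close> acts there.\<close>

definition invariant :: "complex \<Rightarrow> int list \<Rightarrow> (bool list \<Rightarrow> complex) \<Rightarrow> bool" where
  "invariant q w x \<longleftrightarrow> (\<forall>g. wact q g w x = (\<lambda>z. counit g * x z))"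

text \<open>Commutation is required on sign lists of every length, also on those too short for the
  word; there it is ensured by the value 0 that the operators below take on lists too short for
  them.\<close>

definition intertwines ::
    "complex \<Rightarrow> int list \<Rightarrow> int list \<Rightarrow> ((bool list \<Rightarrow> complex) \<Rightarrow> bool list \<Rightarrow> complex) \<Rightarrow> bool" where
  "intertwines q w w' T \<longleftrightarrow>
     (\<forall>c d x y. T (\<lambda>z. c * x z + d * y z) = (\<lambda>z. c * T x z + d * T y z)) \<and>
     (\<forall>g x. wact q g w' (T x) = T (wact q g w x))"

lemma wact_linear:
  "wact q g w (\<lambda>z. c * x z + d * y z) z = c * wact q g w x z + d * wact q g w y z"
proof (induction w arbitrary: g x y z)
  case (Cons a w)
  note IH = Cons.IH
  show ?case
  proof (cases z)
    case (Cons b z')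
    then show ?thesis by (cases g) (simp_all add: IH ring_distribs mult.left_commute)
  qed simp
qed (simp add: algebra_simps)

lemma wact_linears:
  "wact q g w (\<lambda>z. c * x z) z = c * wact q g w x z"
  "wact q g w (\<lambda>z. x z + y z) z = wact q g w x z + wact q g w y z"
  "wact q g w (\<lambda>z. x z - y z) z = wact q g w x z - wact q g w y z"
  "wact q g w (\<lambda>z. - x z) z = - wact q g w x z"
  "wact q g w (\<lambda>z. 0) z = 0"
  using wact_linear[of q g w c x 0 x] wact_linear[of q g w 1 x 1 y]
    wact_linear[of q g w 1 x "-1" y] wact_linear[of q g w "-1" x 0 y]
    wact_linear[of q g w 0 x 0 y] by simp_all

lemma invariant_intertwines:
  assumes T: "intertwines q w w' T" and x: "invariant q w x"
  shows "invariant q w' (T x)"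
proof -
  have "T (\<lambda>z. c * x z) = (\<lambda>z. c * T x z)" for c
    using T[unfolded intertwines_def, THEN conjunct1, rule_format, of c x 0 x] by simp
  with assms show ?thesis by (simp add: invariant_def intertwines_def)
qed

text \<open>The tensor product of the identity of the first letter with \<open>T\<close>.\<close>

fun lift :: "((bool list \<Rightarrow> complex) \<Rightarrow> bool list \<Rightarrow> complex) \<Rightarrow> (bool list \<Rightarrow> complex) \<Rightarrow> bool list \<Rightarrow> complex" where
  "lift T x [] = 0"
| "lift T x (b # z) = T (\<lambda>y. x (b # y)) z"

text \<open>By the coproduct every generator acts on the letters after \<open>a\<close> through
  generators or the identity, and the linear operator \<open>T\<close> commutes with all of
  these.\<close>

lemma intertwines_lift:
  assumes "intertwines q w w' T"
  shows "intertwines q (a # w) (a # w') (lift T)"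
proof -
  have lin: "T (\<lambda>z. c * x z + d * y z) = (\<lambda>z. c * T x z + d * T y z)" for c d x y
    using assms by (simp add: intertwines_def)
  have com: "wact q g w' (T x) = T (wact q g w x)" for g x
    using assms by (simp add: intertwines_def)
  have lins: "T (\<lambda>z. c * x z) z = c * T x z" "T (\<lambda>z. x z + y z) z = T x z + T y z"
    "T (\<lambda>z. x z + c * y z) z = T x z + c * T y z" "T (\<lambda>z. c * x z + y z) z = c * T x z + T y z"
    for c x y z
    using lin[of c x 0 x] lin[of 1 x 1 y] lin[of 1 x c y] lin[of c x 1 y] by simp_all
  show ?thesis
    unfolding intertwines_def
  proof (intro conjI allI ext)
    show "lift T (\<lambda>z. c * x z + d * y z) z = c * lift T x z + d * lift T y z" for c d x y z
      by (cases z) (simp_all add: lin)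
    show "wact q g (a # w') (lift T x) z = lift T (wact q g (a # w) x) z" for g x z
    proof (cases z)
      case (Cons b z')
      then show ?thesis
        by (cases g; cases b) (simp_all add: lins com)
    qed simp
  qed
qed

text \<open>
  The R-matrix from \<open>c \<otimes> b\<close> to \<open>b \<otimes> c\<close>, normalized so as to be polynomial (and nonzero) for
  all values of the parameters.
\<close>

fun braid :: "complex \<Rightarrow> int \<Rightarrow> int \<Rightarrow> (bool list \<Rightarrow> complex) \<Rightarrow> bool list \<Rightarrow> complex" where
  "braid q c b x (s # t # z) =
     (if s = t then (q powi c - q^2 * q powi b) * x (s # t # z)
      else q * (q powi c - q powi b) * x (t # s # z)
        + (1 - q^2) * q powi (if s then c else b) * x (s # t # z))"
| "braid q c b x _ = 0"

text \<open>The tail \<open>v\<close> enters only through the actions of the generators on it. For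
  each generator and each pair of signs at the first two letters, what remains is an identity of
  rational functions in \<open>q\<close>, \<open>q powi c\<close> and
  \<open>q powi b\<close>.\<close>

lemma intertwines_braid:
  assumes "q \<noteq> 0"
  shows "intertwines q (c # b # v) (b # c # v) (braid q c b)"
  unfolding intertwines_def
proof (intro conjI allI ext)
  show "braid q c b (\<lambda>z. k * x z + d * y z) z = k * braid q c b x z + d * braid q c b y z" for k d x y z
    by (cases "(q, c, b, x, z)" rule: braid.cases) (simp_all add: algebra_simps)
  show "wact q g (b # c # v) (braid q c b x) z = braid q c b (wact q g (c # b # v) x) z" for g x z
  proof (cases "(q, c, b, x, z)" rule: braid.cases)
    case (1 q' c' b' x' s t z')
    define m n where "m = q powi c" and "n = q powi b"
    then have mn: "m \<noteq> 0" "n \<noteq> 0" "q powi c = m" "q powi b = n"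
      "q powi (- c) = inverse m" "q powi (- b) = inverse n"
      using assms by (simp_all add: power_int_minus)
    have z: "z = s # t # z'" using 1 by simp
    show ?thesis unfolding z
      by (cases g; cases s; cases t)
        (use assms mn(1,2) in \<open>simp_all add: wact_linears kweight_def mn(3-)\<close>,
          (simp_all add: divide_simps)?, (simp_all add: algebra_simps power2_eq_square)?)
  next
    case ("2_1" q' c' b' x')
    then show ?thesis by simp
  next
    case ("2_2" q' c' b' x' s)
    then show ?thesis by (cases g) simp_all
  qed
qed

text \<open>Tensoring on the left with \<open>v\<^sub>- \<otimes> v\<^sub>+ - q v\<^sub>+ \<otimes>
  v\<^sub>-\<close>, the invariant of the two letters of an arc.\<close>

fun cup :: "complex \<Rightarrow> (bool list \<Rightarrow> complex) \<Rightarrow> bool list \<Rightarrow> complex" where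
  "cup q x (s # t # z) = (if s = t then 0 else if s then - q * x z else x z)"
| "cup q x _ = 0"

text \<open>\<open>E1\<close> and \<open>F1\<close> annihilate the inserted vector whatever the two
  letters are; \<open>E0\<close> and \<open>F0\<close> do so because the second letter exceeds the
  first by 2.\<close>

lemma intertwines_cup:
  assumes "q \<noteq> 0"
  shows "intertwines q v (a # (a + 2) # v) (cup q)"
  unfolding intertwines_def
proof (intro conjI allI ext)
  show "cup q (\<lambda>z. k * x z + d * y z) z = k * cup q x z + d * cup q y z" for k d x y z
    by (cases "(q, x, z)" rule: cup.cases) (simp_all add: algebra_simps)
  show "wact q g (a # (a + 2) # v) (cup q x) z = cup q (wact q g v x) z" for g x z
  proof (cases "(q, x, z)" rule: cup.cases)
    case (1 q' x' s t z')
    define m where "m = q powi a"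
    then have mn: "m \<noteq> 0" "q powi a = m" "q powi (- a) = inverse m"
      "q powi (a + 2) = q^2 * m" "q powi (- a - 2) = inverse (q^2 * m)"
      using assms by (simp_all add: power_int_add power_int_minus power_int_diff divide_inverse)
    have z: "z = s # t # z'" using 1 by simp
    show ?thesis unfolding z
      by (cases g; cases s; cases t)
        (use assms mn(1) in \<open>simp_all add: wact_linears kweight_def mn(2-)\<close>,
          (simp_all add: divide_simps)?, (simp_all add: algebra_simps power2_eq_square)?)
  next
    case ("2_1" q' x')
    then show ?thesis by simp
  next
    case ("2_2" q' x' s)
    then show ?thesis by (cases g) simp_all
  qed
qed

section \<open>Moving a letter and inserting an arc inside a word\<close>

lemma lift_power_append: "length s = p \<Longrightarrow> (lift ^^ p) T x (s @ z) = T (\<lambda>y. x (s @ y)) z"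
proof (induction p arbitrary: s x)
  case (Suc p)
  then show ?case by (cases s) auto
qed simp

lemma intertwines_lift_power:
  "intertwines q w w' T \<Longrightarrow> intertwines q (u @ w) (u @ w') ((lift ^^ length u) T)"
  by (induction u) (simp_all add: intertwines_lift)

lemma power_int_inject:
  fixes q :: complex
  assumes "q \<noteq> 0" "\<And>m::nat. m > 0 \<Longrightarrow> q ^ m \<noteq> 1" "q powi a = q powi b"
  shows "a = b"
proof -
  \<comment> \<open>The hypothesis speaks of natural exponents only, so both differences are kept:
    if \<open>a \<noteq> b\<close>, one of them is positive.\<close>
  have "q powi (a - b) = 1" "q powi (b - a) = 1"
    using assms(1,3) by (simp_all add: power_int_diff)
  then have "q ^ nat (a - b) = 1 \<or> \<not> a > b" "q ^ nat (b - a) = 1 \<or> \<not> b > a"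
    by (auto simp: power_int_def)
  then have "\<not> a > b" "\<not> b > a"
    using assms(2)[of "nat (a - b)"] assms(2)[of "nat (b - a)"] by auto
  then show ?thesis by simp
qed

text \<open>
  That \<open>x\<close> vanishes on patterns with \<open>+\<close> at \<open>c\<close> and everywhere to its left kills the second term
  of the R-matrix on the leading patterns, and the condition is preserved by each move.
\<close>

lemma move_letter_right:
  assumes q: "q \<noteq> 0" "\<And>m::nat. m > 0 \<Longrightarrow> q ^ m \<noteq> 1"
    and "invariant q (u @ c # M @ v) x" "c \<notin> set M"
    and "\<And>z. x (replicate (Suc (length u)) True @ z) = 0"
  shows "\<exists>y k. k \<noteq> 0 \<and> invariant q (u @ M @ c # v) y \<and>
    (\<forall>z. y (replicate (length u + length M) True @ False # z) =
       k * x (replicate (length u) True @ False # replicate (length M) True @ z)) \<and>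
    (\<forall>z. y (replicate (Suc (length u + length M)) True @ z) = 0)"
  using assms(3-)
proof (induction M arbitrary: u x)
  case Nil
  then show ?case by (intro exI[of _ x] exI[of _ 1]) simp
next
  case (Cons b M)
  define x' where "x' = (lift ^^ length u) (braid q c b) x"
  have "invariant q (u @ b # c # M @ v) x'"
    unfolding x'_def using Cons.prems(1)
    by (intro invariant_intertwines[OF intertwines_lift_power[OF intertwines_braid[OF q(1)]]]) simp
  \<comment> \<open>The letter \<open>b\<close> now counts as part of the prefix, so that the
    induction hypothesis moves \<open>c\<close> past the rest of \<open>M\<close>.\<close>
  then have inv: "invariant q ((u @ [b]) @ c # M @ v) x'" by simp
  have x': "x' (replicate (length u) True @ z) = braid q c b (\<lambda>y. x (replicate (length u) True @ y)) z" for z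
    unfolding x'_def by (rule lift_power_append) simp
  have x0: "x (replicate (length u) True @ True # z) = 0" for z
    using Cons.prems(3)[of z] by (simp add: replicate_app_Cons_same)
  have "x' (replicate (length u) True @ True # True # z) = 0" for z
    unfolding x' by (simp add: x0)
  then have "x' (replicate (Suc (length (u @ [b]))) True @ z) = 0" for z
    by (simp add: replicate_app_Cons_same)
  then obtain y k where y: "k \<noteq> 0" "invariant q ((u @ [b]) @ M @ c # v) y"
    "\<And>z. y (replicate (length (u @ [b]) + length M) True @ False # z) =
       k * x' (replicate (length (u @ [b])) True @ False # replicate (length M) True @ z)"
    "\<And>z. y (replicate (Suc (length (u @ [b]) + length M)) True @ z) = 0"
    using Cons.IH[OF inv] Cons.prems(2) by auto
  have neq: "q powi c \<noteq> q powi b" using power_int_inject[OF q, of c b] Cons.prems(2) by auto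
  have "x' (replicate (length (u @ [b])) True @ False # z) =
      q * (q powi c - q powi b) * x (replicate (length u) True @ False # True # z)" for z
    using x'[of "True # False # z"] by (simp only: braid.simps x0) (simp add: replicate_app_Cons_same)
  with y neq q(1) show ?case
    by (intro exI[of _ y] exI[of _ "k * (q * (q powi c - q powi b))"]) simp
qed

text \<open>Induction step of the construction: the pair \<open>a\<close>, \<open>a + 2\<close> is
  created at the place of \<open>a\<close>, then \<open>a + 2\<close> is carried across
  \<open>M\<close>. Only patterns with + on all letters before the moved one are controlled, which
  is enough for leading terms.\<close>

lemma insert_arc:
  assumes q: "q \<noteq> 0" "\<And>m::nat. m > 0 \<Longrightarrow> q ^ m \<noteq> 1"
    and x: "invariant q (u @ M @ v) x" and M: "a + 2 \<notin> set M"
  shows "\<exists>y k. k \<noteq> 0 \<and> invariant q (u @ a # M @ (a + 2) # v) y \<and>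
    (\<forall>z. y (replicate (Suc (length u + length M)) True @ False # z) =
       k * x (replicate (length u + length M) True @ z)) \<and>
    (\<forall>z. y (replicate (Suc (length u + length M)) True @ True # z) = 0)"
proof -
  define x' where "x' = (lift ^^ length u) (cup q) x"
  have "invariant q (u @ a # (a + 2) # M @ v) x'"
    unfolding x'_def using x
    by (intro invariant_intertwines[OF intertwines_lift_power[OF intertwines_cup[OF q(1)]]]) simp
  then have inv: "invariant q ((u @ [a]) @ (a + 2) # M @ v) x'" by simp
  have x': "x' (replicate (length u) True @ z) = cup q (\<lambda>y. x (replicate (length u) True @ y)) z" for z
    unfolding x'_def by (rule lift_power_append) simp
  \<comment> \<open>\<open>cup\<close> has no component with two equal signs; this gives the
    vanishing condition of \<open>move_letter_right\<close> for the prefix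
    \<open>u @ [a]\<close>.\<close>
  have "x' (replicate (Suc (length (u @ [a]))) True @ z) = 0" for z
    using x'[of "True # True # z"] by (simp add: replicate_app_Cons_same)
  then obtain y k where y: "k \<noteq> 0" "invariant q ((u @ [a]) @ M @ (a + 2) # v) y"
    "\<And>z. y (replicate (length (u @ [a]) + length M) True @ False # z) =
       k * x' (replicate (length (u @ [a])) True @ False # replicate (length M) True @ z)"
    "\<And>z. y (replicate (Suc (length (u @ [a]) + length M)) True @ z) = 0"
    using move_letter_right[OF q inv M] by auto
  have "x' (replicate (length (u @ [a])) True @ False # z) = - q * x (replicate (length u) True @ z)" for z
    using x'[of "True # False # z"] by (simp add: replicate_app_Cons_same)
  with y q(1) show ?thesis
    by (intro exI[of _ y] exI[of _ "k * - q"])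
      (simp add: replicate_add replicate_app_Cons_same)
qed

section \<open>Leading terms and arc configurations\<close>

lemma arc_configD:
  assumes "arc_config w C"
  shows "(i, j) \<in> C \<Longrightarrow> i < j \<and> j < length w \<and> w ! j = w ! i + 2"
    and "(i, j) \<in> C \<Longrightarrow> (i', j') \<in> C \<Longrightarrow> {i, j} \<inter> {i', j'} \<noteq> {} \<Longrightarrow> i = i' \<and> j = j'"
    and "k < length w \<Longrightarrow> (\<exists>j. (k, j) \<in> C) \<or> (\<exists>i. (i, k) \<in> C)"
proof -
  show "(i, j) \<in> C \<Longrightarrow> i < j \<and> j < length w \<and> w ! j = w ! i + 2"
    using assms by (auto simp: arc_config_def arcs_def)
  show "i = i' \<and> j = j'" if "(i, j) \<in> C" "(i', j') \<in> C" "{i, j} \<inter> {i', j'} \<noteq> {}"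
  proof (rule ccontr)
    assume "\<not> (i = i' \<and> j = j')"
    then have "(case (i, j) of (i, j) \<Rightarrow> {i, j}) \<inter> (case (i', j') of (i, j) \<Rightarrow> {i, j}) = {}"
      using assms that(1,2) unfolding arc_config_def
      by (intro disjoint_family_onD[of "\<lambda>(i, j). {i, j}" C]) auto
    with that(3) show False by simp
  qed
  show "(\<exists>j. (k, j) \<in> C) \<or> (\<exists>i. (i, k) \<in> C)" if "k < length w"
  proof -
    have "k \<in> (\<Union>(i, j)\<in>C. {i, j})" using that assms by (simp add: arc_config_def)
    then show ?thesis by auto
  qed
qed

lemma arc_end_not_start:
  assumes "arc_config w C" "(i, k) \<in> C"
  shows "k \<notin> fst ` C"
proof
  assume "k \<in> fst ` C"
  then obtain j where "(k, j) \<in> C" by auto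
  then show False using arc_configD(1)[OF assms] arc_configD(2)[OF assms, of k j] by auto
qed

lemma irreducible_configD:
  assumes "irreducible_config w C" "(i, j) \<in> C" "(i', j') \<in> C" "i < i'" "i' < j" "j < j'"
  shows "w ! i' \<noteq> w ! i" "w ! i' \<noteq> w ! j"
  using assms(1)[unfolded irreducible_config_def, rule_format, OF assms(2,3)] assms(4-) by auto

text \<open>The sign pattern on the positions from \<open>k\<close> on, in a word of length
  \<open>m\<close>.\<close>

definition start_pattern :: "nat \<Rightarrow> (nat \<times> nat) set \<Rightarrow> nat \<Rightarrow> bool list" where
  "start_pattern m C k = map (\<lambda>i. i \<in> fst ` C) [k..<m]"

text \<open>The letters before position \<open>k\<close> that are present once exactly the arcs with
  right end at least \<open>k\<close> are inserted.\<close>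

definition open_starts :: "(nat \<times> nat) set \<Rightarrow> nat \<Rightarrow> nat list" where
  "open_starts C k = filter (\<lambda>i. \<exists>j\<ge>k. (i, j) \<in> C) [0..<k]"

lemma start_pattern_Suc:
  "k < m \<Longrightarrow> start_pattern m C k = (k \<in> fst ` C) # start_pattern m C (Suc k)"
  by (simp add: start_pattern_def upt_conv_Cons)

text \<open>No earlier arc can end at \<open>k\<close>, which is already an end of another arc; so
  all arcs open at \<open>k\<close> stay open.\<close>

lemma open_starts_start:
  assumes C: "arc_config w C" and k: "(k, j) \<in> C"
  shows "open_starts C (Suc k) = open_starts C k @ [k]"
proof -
  have "(\<exists>j\<ge>Suc k. (i, j) \<in> C) \<longleftrightarrow> (\<exists>j\<ge>k. (i, j) \<in> C)" if "i < k" for i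
    using arc_configD(2)[OF C k, of i k] that by (metis Suc_leD disjoint_iff insertCI le_antisym not_less_eq_eq less_irrefl)
  then have "filter (\<lambda>i. \<exists>j\<ge>Suc k. (i, j) \<in> C) [0..<k] = filter (\<lambda>i. \<exists>j\<ge>k. (i, j) \<in> C) [0..<k]"
    by (intro filter_cong) simp_all
  moreover have "\<exists>j\<ge>Suc k. (k, j) \<in> C" using arc_configD(1)[OF C k] k by (auto simp: Suc_le_eq)
  ultimately show ?thesis
    unfolding open_starts_def upt_Suc_append[OF le0] filter_append by simp
qed

text \<open>The arc from \<open>i\<close> is the only one that ends at \<open>k\<close>, so passing
  \<open>k\<close> removes \<open>i\<close> alone; and \<open>k\<close>, being a right end, is not
  added.\<close>

lemma open_starts_end:
  assumes C: "arc_config w C" and k: "(i, k) \<in> C"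
  defines "P \<equiv> \<lambda>b. \<exists>j\<ge>k. (b, j) \<in> C"
  shows "open_starts C k = filter P [0..<i] @ i # filter P [Suc i..<k]"
    and "open_starts C (Suc k) = filter P [0..<i] @ filter P [Suc i..<k]"
proof -
  have ik: "i < k" using arc_configD(1)[OF C k] by simp
  then have u: "[0..<k] = [0..<i] @ i # [Suc i..<k]"
    by (metis less_imp_le_nat upt_add_eq_append upt_conv_Cons le_add_diff_inverse zero_le)
  have "P i" using k unfolding P_def by blast
  then show "open_starts C k = filter P [0..<i] @ i # filter P [Suc i..<k]"
    unfolding open_starts_def P_def[symmetric] u by simp
  have eq: "(\<exists>j\<ge>Suc k. (b, j) \<in> C) \<longleftrightarrow> P b \<and> b \<noteq> i" for b
  proof
    assume "\<exists>j\<ge>Suc k. (b, j) \<in> C"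
    then obtain j where j: "j \<ge> Suc k" "(b, j) \<in> C" by blast
    then have "b \<noteq> i" using arc_configD(2)[OF C k j(2)] by auto
    with j show "P b \<and> b \<noteq> i" unfolding P_def by (auto intro: exI[of _ j])
  next
    assume "P b \<and> b \<noteq> i"
    then obtain j where j: "j \<ge> k" "(b, j) \<in> C" "b \<noteq> i" unfolding P_def by blast
    then have "j \<noteq> k" using arc_configD(2)[OF C k j(2)] by auto
    with j show "\<exists>j\<ge>Suc k. (b, j) \<in> C" by (intro exI[of _ j]) auto
  qed
  have "\<not> (P k \<and> k \<noteq> i)"
  proof
    assume "P k \<and> k \<noteq> i"
    then obtain j where "(k, j) \<in> C" "k \<noteq> i" unfolding P_def by blast
    then show False using arc_configD(2)[OF C k, of k j] by auto
  qed
  moreover have "filter (\<lambda>b. P b \<and> b \<noteq> i) [0..<i] = filter P [0..<i]"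
    "filter (\<lambda>b. P b \<and> b \<noteq> i) [Suc i..<k] = filter P [Suc i..<k]"
    by (intro filter_cong; auto)+
  ultimately show "open_starts C (Suc k) = filter P [0..<i] @ filter P [Suc i..<k]"
    using ik unfolding open_starts_def eq upt_Suc_append[OF le0] filter_append u by simp
qed

text \<open>Induction on \<open>k\<close> downwards from the end of the word. Leading terms are
  compared only among patterns with + on all open left ends; at \<open>k = 0\<close> no left end is
  open and the comparison covers all patterns.\<close>

lemma invariant_with_leading_pattern:
  assumes q: "q \<noteq> 0" "\<And>m::nat. m > 0 \<Longrightarrow> q ^ m \<noteq> 1"
    and C: "arc_config w C" "irreducible_config w C" and k: "k \<le> length w"
  defines "s \<equiv> start_pattern (length w) C" and "p \<equiv> \<lambda>k. replicate (length (open_starts C k)) True"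
  shows "\<exists>x. invariant q (map ((!) w) (open_starts C k) @ drop k w) x \<and> x (p k @ s k) \<noteq> 0 \<and>
    (\<forall>t. length t = length (s k) \<longrightarrow> s k < t \<longrightarrow> x (p k @ t) = 0)"
  using k
proof (induction k rule: inc_induct)
  case base
  have "open_starts C (length w) = []" "s (length w) = []"
    using arc_configD(1)[OF C(1)]
    by (auto simp: open_starts_def s_def start_pattern_def filter_empty_conv not_le)
  \<comment> \<open>No arc is inserted yet and the word is empty, so the constant 1 is
    invariant.\<close>
  then show ?case by (intro exI[of _ "\<lambda>_. 1"]) (simp add: invariant_def fun_eq_iff)
next
  case (step k)
  then obtain x where x: "invariant q (map ((!) w) (open_starts C (Suc k)) @ drop (Suc k) w) x"
    "x (p (Suc k) @ s (Suc k)) \<noteq> 0"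
    "\<And>t. length t = length (s (Suc k)) \<Longrightarrow> s (Suc k) < t \<Longrightarrow> x (p (Suc k) @ t) = 0" by blast
  have dr: "drop k w = w ! k # drop (Suc k) w" using step.hyps by (simp add: Cons_nth_drop_Suc)
  have sk: "s k = (k \<in> fst ` C) # s (Suc k)"
    unfolding s_def using step.hyps by (intro start_pattern_Suc) simp
  consider j where "(k, j) \<in> C" | i where "(i, k) \<in> C"
    using arc_configD(3)[OF C(1), of k] step.hyps by auto
  then show ?case
  proof cases
    \<comment> \<open>\<open>k\<close> is a left end: the word stays the same, its letter merely
      passes from the open left ends to the tail, and the vector is kept.\<close>
    case 1
    have "k \<in> fst ` C" using 1 by force
    then have sk: "s k = True # s (Suc k)" using sk by simp
    have os: "open_starts C (Suc k) = open_starts C k @ [k]" by (rule open_starts_start[OF C(1) 1])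
    then have p: "p (Suc k) @ t = p k @ True # t" for t
      by (simp add: p_def replicate_app_Cons_same)
    have "x (p k @ t) = 0" if "length t = length (s k)" "s k < t" for t
    proof -
      from that sk obtain t' where "t = True # t'" "length t' = length (s (Suc k))" "s (Suc k) < t'"
        by (cases t) auto
      then show ?thesis using x(3) p by metis
    qed
    then show ?thesis using x(1,2) by (intro exI[of _ x]) (simp add: os dr sk p)
  next
    case 2
    have "k \<notin> fst ` C" by (rule arc_end_not_start[OF C(1) 2])
    then have sk: "s k = False # s (Suc k)" using sk by simp
    let ?P = "\<lambda>b. \<exists>j\<ge>k. (b, j) \<in> C"
    let ?A = "filter ?P [0..<i]" and ?B = "filter ?P [Suc i..<k]"
    note os = open_starts_end[OF C(1) 2]
    have wk: "w ! k = w ! i + 2" using arc_configD(1)[OF C(1) 2] by simp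
    \<comment> \<open>An open left end \<open>b\<close> between \<open>i\<close> and
      \<open>k\<close> belongs to an arc that ends after \<open>k\<close> and so crosses
      \<open>(i, k)\<close>; irreducibility separates the letters.\<close>
    have "w ! k \<noteq> w ! b" if "b \<in> set ?B" for b
    proof -
      from that obtain j where b: "i < b" "b < k" "k \<le> j" "(b, j) \<in> C" by auto
      moreover have "j \<noteq> k" using arc_configD(2)[OF C(1) 2 b(4)] b(1) by auto
      ultimately show ?thesis using irreducible_configD(2)[OF C(2) 2 b(4)] by auto
    qed
    then have "w ! i + 2 \<notin> set (map ((!) w) ?B)" unfolding wk by auto
    moreover have "invariant q (map ((!) w) ?A @ map ((!) w) ?B @ drop (Suc k) w) x"
      using x(1) unfolding os(2) by simp
    ultimately obtain y c where y: "c \<noteq> 0"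
      "invariant q (map ((!) w) ?A @ w ! i # map ((!) w) ?B @ (w ! i + 2) # drop (Suc k) w) y"
      "\<And>z. y (replicate (Suc (length ?A + length ?B)) True @ False # z) =
         c * x (replicate (length ?A + length ?B) True @ z)"
      "\<And>z. y (replicate (Suc (length ?A + length ?B)) True @ True # z) = 0"
      using insert_arc[OF q, of "map ((!) w) ?A" "map ((!) w) ?B" "drop (Suc k) w" x "w ! i"]
      unfolding length_map by blast
    have p: "p k = replicate (Suc (length ?A + length ?B)) True"
      "p (Suc k) = replicate (length ?A + length ?B) True"
      by (simp_all add: p_def os)
    \<comment> \<open>As \<open>s k\<close> begins with \<open>False\<close>, a larger
      \<open>t\<close> either begins with \<open>True\<close>, where \<open>y\<close> vanishes, or
      has a larger tail, where \<open>x\<close> vanishes.\<close>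
    have "y (p k @ t) = 0" if "length t = length (s k)" "s k < t" for t
    proof (cases t)
      case (Cons b t')
      then show ?thesis using that x(3)[of t'] sk y(3)[of t'] y(4)[of t'] unfolding p
        by (cases b) auto
    qed (use that sk in simp)
    moreover have "y (p k @ s k) \<noteq> 0" unfolding p sk y(3) using y(1) x(2) p(2) by simp
    moreover have "invariant q (map ((!) w) (open_starts C k) @ drop k w) y"
      using y(2) unfolding os(1) dr wk by simp
    ultimately show ?thesis by blast
  qed
qed

text \<open>
  Compare the arcs \<open>(i, j)\<close> and \<open>(i', j)\<close> by induction on \<open>j\<close>.  If \<open>i < i'\<close>, the arc of \<open>C\<close>
  starting at \<open>i'\<close> cannot end before \<open>j\<close>, as it would then belong to \<open>C'\<close> too; so it crosses
  \<open>(i, j)\<close> reducibly, since \<open>w ! i = w ! i'\<close>.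
\<close>

lemma irreducible_config_determined_by_starts:
  assumes C: "arc_config w C" "irreducible_config w C"
    and C': "arc_config w C'" "irreducible_config w C'"
    and starts: "fst ` C = fst ` C'"
  shows "C = C'"
proof -
  \<comment> \<open>Stated for arbitrary \<open>D\<close> and \<open>D'\<close> because both
    inclusions are needed at each step of the induction.\<close>
  have sub: "(i, j) \<in> D'"
    if D: "arc_config w D" "irreducible_config w D" and D': "arc_config w D'" "irreducible_config w D'"
      and starts: "fst ` D = fst ` D'"
      and IH: "\<And>i j'. j' < j \<Longrightarrow> (i, j') \<in> D \<longleftrightarrow> (i, j') \<in> D'" and ij: "(i, j) \<in> D"
    for D D' i j
  proof -
    have start: "\<exists>j. (i, j) \<in> D" "\<exists>j. (i, j) \<in> D'" if "i \<in> fst ` D" for i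
      using that starts by force+
    \<comment> \<open>A right end of \<open>D\<close> is no left end of \<open>D'\<close> either, so
      some arc of \<open>D'\<close> ends at \<open>j\<close>.\<close>
    have "j \<notin> fst ` D" by (rule arc_end_not_start[OF D(1) ij])
    then have "\<not> (\<exists>k. (j, k) \<in> D')" using starts by force
    moreover have "j < length w" using arc_configD(1)[OF D(1) ij] by simp
    ultimately obtain i' where i': "(i', j) \<in> D'" using arc_configD(3)[OF D'(1)] by blast
    have lt: "i < j" "i' < j" and weq: "w ! i = w ! i'"
      using arc_configD(1)[OF D(1) ij] arc_configD(1)[OF D'(1) i'] by auto
    consider "i = i'" | "i < i'" | "i' < i" by linarith
    then show ?thesis
    proof cases
      case 1
      with i' show ?thesis by simp
    next
      case 2
      have "i' \<in> fst ` D" using i' starts by force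
      then obtain j1 where j1: "(i', j1) \<in> D" using start by blast
      have "j1 \<noteq> j" using arc_configD(2)[OF D(1) ij j1] 2 by auto
      moreover have "\<not> j1 < j" using IH[of j1 i'] j1 arc_configD(2)[OF D'(1) i', of i' j1] by auto
      ultimately show ?thesis using irreducible_configD(1)[OF D(2) ij j1] 2 lt weq by auto
    next
      \<comment> \<open>Mirror image: now the arc of \<open>D'\<close> that starts at
        \<open>i\<close> crosses \<open>(i', j)\<close> reducibly.\<close>
      case 3
      have "i \<in> fst ` D" using ij by force
      then obtain j1 where j1: "(i, j1) \<in> D'" using start by blast
      have "j1 \<noteq> j" using arc_configD(2)[OF D'(1) i' j1] 3 by auto
      moreover have "\<not> j1 < j" using IH[of j1 i] j1 arc_configD(2)[OF D(1) ij, of i j1] by auto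
      ultimately show ?thesis using irreducible_configD(1)[OF D'(2) i' j1] 3 lt weq by auto
    qed
  qed
  have "(i, j) \<in> C \<longleftrightarrow> (i, j) \<in> C'" for i j
  proof (induction j arbitrary: i rule: less_induct)
    case (less j)
    then show ?case using sub[OF C C' starts, of j i] sub[OF C' C starts[symmetric], of j i] by blast
  qed
  then show ?thesis by auto
qed

lemma start_pattern_inj_on: "inj_on (\<lambda>C. start_pattern (length w) C 0) (IConf w)"
proof (rule inj_onI)
  fix C C' assume C: "C \<in> IConf w" "C' \<in> IConf w"
    and eq: "start_pattern (length w) C 0 = start_pattern (length w) C' 0"
  have "i \<in> fst ` C \<longleftrightarrow> i \<in> fst ` C'" if "i < length w" for i
    using eq that by (auto simp: start_pattern_def)
  moreover have "fst ` D \<subseteq> {..<length w}" if "D \<in> IConf w" for D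
    using that arc_configD(1)[of w D] by (fastforce simp: IConf_def)
  ultimately have "fst ` C = fst ` C'" using C by blast
  then show "C = C'" using C irreducible_config_determined_by_starts by (auto simp: IConf_def)
qed

section \<open>Comparison with the matrix model\<close>

text \<open>The signs of the basis vector with index \<open>i\<close> in the order of the Kronecker
  product: binary digits of \<open>i\<close>, most significant first, with 0 for
  \<open>v\<^sub>+\<close>.\<close>

primrec basis_signs :: "nat \<Rightarrow> nat \<Rightarrow> bool list" where
  "basis_signs 0 i = []"
| "basis_signs (Suc n) i = (i div 2 ^ n = 0) # basis_signs n (i mod 2 ^ n)"

lemma length_basis_signs [simp]: "length (basis_signs n i) = n"
  by (induction n arbitrary: i) simp_all

lemma basis_signs_surj: "length z = n \<Longrightarrow> \<exists>i<2 ^ n. basis_signs n i = z"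
proof (induction n arbitrary: z)
  case (Suc n)
  then obtain b z' where z: "z = b # z'" "length z' = n" by (cases z) auto
  with Suc.IH obtain i where "i < 2 ^ n" "basis_signs n i = z'" by blast
  with z show ?case by (intro exI[of _ "(if b then 0 else 2 ^ n) + i"]) auto
qed simp

text \<open>Splits off the two-dimensional factor of the first letter, as the clauses of
  \<open>wact\<close> do.\<close>

lemma kron_apply:
  assumes "A \<in> carrier_mat 2 2" "B \<in> carrier_mat N N" "i < 2 * N"
  shows "(\<Sum>j<2 * N. (A \<otimes>\<^sub>m B) $$ (i, j) * f (j div N) (j mod N)) =
    A $$ (i div N, 0) * (\<Sum>l<N. B $$ (i mod N, l) * f 0 l) +
    A $$ (i div N, 1) * (\<Sum>l<N. B $$ (i mod N, l) * f 1 l)"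
proof -
  have "(\<Sum>j<2 * N. (A \<otimes>\<^sub>m B) $$ (i, j) * f (j div N) (j mod N)) =
      (\<Sum>j<2 * N. A $$ (i div N, j div N) * (B $$ (i mod N, j mod N) * f (j div N) (j mod N)))"
    using assms by (intro sum.cong) (auto simp: kron_index)
  also have "\<dots> = (\<Sum>k<2. \<Sum>l<N. A $$ (i div N, k) * (B $$ (i mod N, l) * f k l))"
    by (rule sum_div_mod[where f = "\<lambda>k l. A $$ (i div N, k) * (B $$ (i mod N, l) * f k l)"])
  finally show ?thesis by (simp add: numeral_2_eq_2 sum_distrib_left)
qed

lemma udim_word_umod [simp]: "udim (word_umod q w) = 2 ^ length w"
  by (induction w) (simp_all add: trivial_umod_def tensor_def eval_umod_def)

lemma eval_act_carrier: "eval_act q a g \<in> carrier_mat 2 2"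
  by (cases g) (simp_all add: mat_of_rows_list_def numeral_2_eq_2)

lemma act_word_umod_carrier: "act (word_umod q w) g \<in> carrier_mat (2 ^ length w) (2 ^ length w)"
proof (induction w arbitrary: g)
  case Nil
  show ?case by (cases g) (simp_all add: trivial_umod_def)
next
  case (Cons a w)
  have "udim (eval_umod q a) = 2" "act (eval_umod q a) = eval_act q a" by (simp_all add: eval_umod_def)
  then show ?case
    by (cases g; simp only: word_umod.simps tensor_def umod.simps tensor_act.simps udim_word_umod
          length_Cons power_Suc; intro add_carrier_mat kron_carrier one_carrier_mat eval_act_carrier Cons.IH)
qed

lemma act_word_umod_apply:
  assumes "i < 2 ^ length w"
  shows "(\<Sum>j<2 ^ length w. act (word_umod q w) g $$ (i, j) * x (basis_signs (length w) j)) =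
    wact q g w x (basis_signs (length w) i)"
  using assms
proof (induction w arbitrary: g x i)
  case Nil
  then show ?case by (cases g) (simp_all add: trivial_umod_def)
next
  case (Cons a w)
  define N :: nat where "N = 2 ^ length w"
  define f where "f k l = x ((k = 0) # basis_signs (length w) l)" for k l :: nat
  have N: "2 ^ length (a # w) = 2 * N" "0 < N" by (simp_all add: N_def)
  have i: "i < 2 * N" "i mod N < N" using Cons.prems N by simp_all
  then have "i div N < 2" by (simp add: less_mult_imp_div_less)
  then have d: "i div N = 0 \<or> i div N = 1" by linarith
  have x: "x (basis_signs (length (a # w)) j) = f (j div N) (j mod N)" for j
    by (simp add: f_def N_def)
  have act: "act (word_umod q (a # w)) = tensor_act (eval_umod q a) (word_umod q w)"
    "act (eval_umod q a) = eval_act q a" "udim (eval_umod q a) = 2" "udim (word_umod q w) = N"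
    by (simp_all add: tensor_def eval_umod_def N_def)
  have cw: "act (word_umod q w) g \<in> carrier_mat N N" for g
    unfolding N_def by (rule act_word_umod_carrier)
  have IH: "(\<Sum>l<N. act (word_umod q w) g $$ (i mod N, l) * f k l) =
      wact q g w (\<lambda>z. x ((k = 0) # z)) (basis_signs (length w) (i mod N))" for g k
    using Cons.IH[of "i mod N" g "\<lambda>z. x ((k = 0) # z)"] i unfolding N_def f_def by simp
  have one: "(\<Sum>l<N. 1\<^sub>m N $$ (i mod N, l) * f k l) = f k (i mod N)" for k
    using i by (subst sum.remove[of _ "i mod N"]) (auto intro!: sum.neutral)
  have add: "(\<Sum>j<2 * N. (A + B) $$ (i, j) * y j) = (\<Sum>j<2 * N. A $$ (i, j) * y j) + (\<Sum>j<2 * N. B $$ (i, j) * y j)"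
    if "A \<in> carrier_mat (2 * N) (2 * N)" "B \<in> carrier_mat (2 * N) (2 * N)" for A B :: "complex mat" and y
    unfolding sum.distrib[symmetric]
    by (rule sum.cong[OF refl]) (use carrier_matD[OF that(1)] carrier_matD[OF that(2)] i(1) in \<open>simp add: ring_distribs\<close>)
  note kc = kron_carrier[OF eval_act_carrier cw] kron_carrier[OF one_carrier_mat cw, of 2]
    kron_carrier[OF eval_act_carrier one_carrier_mat[of N]]
  note ka = kron_apply[OF eval_act_carrier cw i(1), where f = f] kron_apply[OF one_carrier_mat cw i(1), where f = f]
    kron_apply[OF eval_act_carrier one_carrier_mat i(1), where f = f]
  have bs: "basis_signs (length (a # w)) i = (i div N = 0) # basis_signs (length w) (i mod N)"
    by (simp add: N_def)
  have fx: "f k (i mod N) = x ((k = 0) # basis_signs (length w) (i mod N))" for k by (simp add: f_def)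
  \<comment> \<open>The two instances of \<open>add\<close> match the coproducts of
    \<open>E0\<close>, \<open>E1\<close> and of \<open>F0\<close>, \<open>F1\<close>; the cases of
    \<open>d\<close> are the two rows of the first factor.\<close>
  show ?case
    unfolding N x bs act(1)
    by (cases g; simp only: tensor_act.simps act add[OF kc(1) kc(2)] add[OF kc(3) kc(1)] ka IH one fx;
        rule disjE[OF d]; simp add: mat_of_rows_list_def kweight_def)
qed

section \<open>Invariant vectors as homomorphisms, and the dimension bound\<close>

definition column_of :: "nat \<Rightarrow> (bool list \<Rightarrow> complex) \<Rightarrow> complex mat" where
  "column_of n x = mat (2 ^ n) 1 (\<lambda>(i, _). x (basis_signs n i))"

lemma column_of_in_Hom_U:
  assumes "invariant q w x"
  shows "column_of (length w) x \<in> Hom_U trivial_umod (word_umod q w)"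
proof -
  let ?X = "column_of (length w) x"
  have X: "?X \<in> carrier_mat (2 ^ length w) 1" by (simp add: column_of_def)
  have "?X * act trivial_umod g = act (word_umod q w) g * ?X" for g
  proof -
    have A: "act (word_umod q w) g \<in> carrier_mat (2 ^ length w) (2 ^ length w)"
      by (rule act_word_umod_carrier)
    have T: "act trivial_umod g = counit g \<cdot>\<^sub>m 1\<^sub>m 1"
      by (cases g) (auto simp: trivial_umod_def intro!: eq_matI)
    have "act (word_umod q w) g * ?X = counit g \<cdot>\<^sub>m ?X"
    proof (rule eq_matI)
      fix i j assume "i < dim_row (counit g \<cdot>\<^sub>m ?X)" "j < dim_col (counit g \<cdot>\<^sub>m ?X)"
      then have ij: "i < 2 ^ length w" "j = 0" by (simp_all add: column_of_def)
      have "(act (word_umod q w) g * ?X) $$ (i, j) =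
          (\<Sum>j<2 ^ length w. act (word_umod q w) g $$ (i, j) * x (basis_signs (length w) j))"
        using ij A by (auto simp: column_of_def scalar_prod_def lessThan_atLeast0 intro!: sum.cong)
      also have "\<dots> = counit g * x (basis_signs (length w) i)"
        using act_word_umod_apply[OF ij(1)] assms by (simp add: invariant_def)
      also have "\<dots> = (counit g \<cdot>\<^sub>m ?X) $$ (i, j)"
        using ij by (simp add: column_of_def)
      finally show "(act (word_umod q w) g * ?X) $$ (i, j) = (counit g \<cdot>\<^sub>m ?X) $$ (i, j)" .
    qed (use A in \<open>simp_all add: column_of_def\<close>)
    moreover have "?X * act trivial_umod g = counit g \<cdot>\<^sub>m ?X"
      unfolding T mult_smult_distrib[OF X one_carrier_mat] right_mult_one_mat[OF X] ..
    ultimately show ?thesis by simp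
  qed
  then show ?thesis using X by (simp add: Hom_U_def trivial_umod_def)
qed

lemma column_of_index:
  "i < 2 ^ n \<Longrightarrow> column_of n x $$ (i, 0) = x (basis_signs n i)"
  by (simp add: column_of_def)

lemma dim_Hom_U_ge:
  assumes q: "q \<noteq> 0" "q^2 \<noteq> 1"
    and I: "finite I" "inj_on lead I" "\<And>i. i \<in> I \<Longrightarrow> length (lead i) = length w"
    and inv: "\<And>i. i \<in> I \<Longrightarrow> invariant q w (x i)"
    and nz: "\<And>i. i \<in> I \<Longrightarrow> x i (lead i) \<noteq> 0"
    and z: "\<And>i t. i \<in> I \<Longrightarrow> length t = length w \<Longrightarrow> lead i < t \<Longrightarrow> x i t = 0"
  shows "card I \<le> word_h q w"
proof -
  let ?n = "length w"
  let ?N = "(2::nat) ^ ?n"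
  let ?H = "Hom_U trivial_umod (word_umod q w)"
  define X where "X i = column_of ?n (x i)" for i
  interpret M: matrix_vs ?N 1 "TYPE(complex)" .
  have H: "subspace class_ring ?H (module_mat TYPE(complex) ?N 1)"
    using Hom_U_subspace[OF U_module_trivial U_module_word[OF q], of w]
    by (simp add: trivial_umod_def)
  interpret W: vectorspace class_ring "(module_mat TYPE(complex) ?N 1)\<lparr>carrier := ?H\<rparr>"
    by (rule M.subspace_is_vs[OF H])
  have XH: "X ` I \<subseteq> ?H" using column_of_in_Hom_U[OF inv] by (auto simp: X_def)
  have Xc: "X ` I \<subseteq> carrier_mat ?N 1" by (auto simp: X_def column_of_def)
  \<comment> \<open>Evaluation at a leading pattern is the reading of one matrix entry, in the same
    row for all columns.\<close>
  have ix: "\<exists>r<?N. \<forall>j. X j $$ (r, 0) = x j (lead i)" if "i \<in> I" for i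
    using basis_signs_surj[OF I(3)[OF that]] by (metis X_def column_of_index)
  have inj: "inj_on X I"
  proof (rule inj_onI)
    fix i j assume ij: "i \<in> I" "j \<in> I" "X i = X j"
    \<comment> \<open>Equal columns agree at both leads; each vanishes above its own lead, so
      neither lead exceeds the other.\<close>
    have "x i (lead j) = x j (lead j)" "x i (lead i) = x j (lead i)"
      using ix[OF ij(1)] ix[OF ij(2)] ij(3) by metis+
    then have "\<not> lead i < lead j" "\<not> lead j < lead i"
      using z[of i "lead j"] z[of j "lead i"] nz I(3) ij(1,2) by auto
    then show "i = j" using I(2) ij(1,2) by (auto dest: inj_onD)
  qed
  have "M.lin_indpt (X ` I)"
  proof (rule M.finite_lin_indpt2)
    fix c assume "M.lincomb c (X ` I) = 0\<^sub>m ?N 1"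
    then have "(\<Sum>Y\<in>X ` I. c Y * Y $$ (r, 0)) = 0" if "r < ?N" for r
      using M.lincomb_index[OF finite_imageI[OF I(1)] Xc that, of 0 c] that by simp
    then have s: "(\<Sum>i\<in>I. c (X i) * X i $$ (r, 0)) = 0" if "r < ?N" for r
      using that by (simp add: sum.reindex[OF inj])
    have "c (X i) = 0" if "i \<in> I" for i
    proof (rule triangular_independent[OF I(1,2), where f = x and c = "\<lambda>i. c (X i)"])
      show "(\<Sum>i\<in>I. c (X i) * x i (lead j)) = 0" if j: "j \<in> I" for j
      proof -
        obtain r where "r < ?N" "\<And>i. X i $$ (r, 0) = x i (lead j)" using ix[OF j] by blast
        then show ?thesis using s[of r] by simp
      qed
    qed (use nz z I(3) that in auto)
    then show "\<forall>v\<in>X ` I. c v = 0" by simp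
  qed (use I(1) Xc in auto)
  moreover have sub: "submodule class_ring ?H (module_mat TYPE(complex) ?N 1)"
    using H by (simp add: subspace_def)
  ultimately have "W.lin_indpt (X ` I)"
    using M.span_li_not_depend(2)[OF XH sub] by simp
  moreover have "W.fin_dim"
    using M.fin_dim_subspace[OF fin_dim_column_matrices H] .
  ultimately have "card (X ` I) \<le> W.dim" using XH by (intro W.li_le_dim) auto
  then show ?thesis
    by (simp add: card_image[OF inj] word_h_def dim_Hom_U_def trivial_umod_def)
qed

theorem theorem5p6:
  fixes q :: complex and n :: nat and w :: "int list"
  assumes q_nonzero: "q \<noteq> 0"
    and q_not_root_of_unity: "\<And>m::nat. m > 0 \<Longrightarrow> q ^ m \<noteq> 1"
    and w_even: "\<And>a. a \<in> set w \<Longrightarrow> even a"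
    and w_length: "length w = 2 * n"
  shows "word_h q w \<ge> card (IConf w)"
proof -
  let ?lead = "\<lambda>C. start_pattern (length w) C 0"
  have "arcs w \<subseteq> {..<length w} \<times> {..<length w}" by (auto simp: arcs_def)
  then have "finite (arcs w)" by (rule finite_subset) simp
  moreover have "IConf w \<subseteq> Pow (arcs w)" by (auto simp: IConf_def arc_config_def)
  ultimately have fin: "finite (IConf w)" by (meson finite_Pow_iff finite_subset)
  have len: "length (?lead C) = length w" for C by (simp add: start_pattern_def)
  \<comment> \<open>Stage \<open>k = 0\<close>: all arcs are inserted and the word is
    complete.\<close>
  have "\<exists>x. invariant q w x \<and> x (?lead C) \<noteq> 0 \<and>
      (\<forall>t. length t = length w \<longrightarrow> ?lead C < t \<longrightarrow> x t = 0)" if "C \<in> IConf w" for C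
    using invariant_with_leading_pattern[OF q_nonzero q_not_root_of_unity, of w C 0] that
    by (simp add: IConf_def open_starts_def len)
  then obtain x where x: "\<And>C. C \<in> IConf w \<Longrightarrow> invariant q w (x C)"
    "\<And>C. C \<in> IConf w \<Longrightarrow> x C (?lead C) \<noteq> 0"
    "\<And>C t. C \<in> IConf w \<Longrightarrow> length t = length w \<Longrightarrow> ?lead C < t \<Longrightarrow> x C t = 0"
    by metis
  show ?thesis
    \<comment> \<open>Exponent 2 gives \<open>q^2 \<noteq> 1\<close>, which makes
      \<open>q - inverse q\<close> invertible in the module relations.\<close>
    by (rule dim_Hom_U_ge[where lead = ?lead and x = x])
      (use q_nonzero q_not_root_of_unity[of 2] fin start_pattern_inj_on len x in auto)
qed

end
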